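(* Let $K$ be an oriented virtual knot diagram, and let $$P_K(t)=\sum_{c}\mathrm{sgn}(c)\,\bigl(t^{W_K(c)}-1\bigr)\in\mathbb{Z}[t,t^{-1}]$$ be its Affine Index Polynomial, where the sum is over all classical crossings $c$ of $K$. Then $P_K(t)$ is invariant under oriented virtual isotopy, i.e. if $K$ and $K'$ are oriented virtual knot diagrams related by oriented virtual isotopy, then $P_K(t)=P_{K'}(t)$. Hence $P_K(t)$ is an invariant of oriented virtual knots.
   Context: A virtual link diagram is a generically immersed collection of closed curves in the plane in which every double point is either a classical crossing (with over/under information) or a virtual crossing (no over/under information). A virtual knot diagram is one with a single component. Virtual isotopy is the equivalence relation on virtual link diagrams, taken up to planar isotopy, generated by the classical Reidemeister moves I, II, III (involving only classical crossings) and the detour move: an arc containing a consecutive sequence of virtual crossings and no classical crossings may be excised and replaced by any other arc with the same endpoints, all of whose crossings with the rest of the diagram and with itself are virtual. (Equivalently, the detour move may be replaced by the purely virtual Reidemeister moves I, II, III and the move sliding an arc with two virtual crossings past a classical crossing.) Oriented virtual isotopy uses all oriented versions of these moves. The underlying flat diagram of a virtual diagram is obtained by forgetting the over/under information at classical crossings. An arc of an oriented diagram is an edge going, in the direction of orientation, from one classical crossing to the next, possibly passing through virtual crossings. (If a component has no classical crossings, the whole component is a single arc.) A Cheng coloring of an oriented (flat) virtual diagram is an assignment of an integer to each arc such that the following holds at each classical crossing. Draw the crossing with both strands directed upward, with left incoming arc labeled $a$ and right incoming arc labeled $b$. Then the right outgoing arc (the continuation of the left incoming strand) is labeled $a-1$,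 and the left outgoing arc (the continuation of the right incoming strand) is labeled $b+1$. Labels do not change at virtual crossings. Every oriented flat virtual knot diagram has a Cheng coloring, unique up to adding a constant integer to all labels. At a classical crossing $c$ with left incoming label $a$ and right incoming label $b$, put $W_+(c)=a-(b+1)$ and $W_-(c)=b-(a-1)=-W_+(c)$. These do not depend on the choice of Cheng coloring of the knot diagram. The sign $\mathrm{sgn}(c)\in\{+1,-1\}$ of a classical crossing is the usual one. With both strands directed upward, $\mathrm{sgn}(c)=+1$ if the overcrossing strand goes from lower left to upper right, and $\mathrm{sgn}(c)=-1$ if it goes from lower right to upper left. The weight of $c$ in $K$ is $W_K(c)=W_+(c)$ if $\mathrm{sgn}(c)=+1$ and $W_K(c)=W_-(c)$ if $\mathrm{sgn}(c)=-1$. *)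

theory Defs
  imports "HOL-Analysis.Analysis" "HOL-Library.Poly_Mapping"
begin

section \<open>Oriented virtual knot diagrams\<close>

text \<open>
  The plane is \<^typ>\<open>complex\<close>. A diagram is given by a 1-periodic parametrisation of its oriented
  curve, so a point of the underlying circle is a real parameter modulo \<^term>\<open>\<int> :: real set\<close>, together
  with the set of those parameters at which the curve passes over at a classical crossing. Double
  points neither of whose two parameters lies in this set are the virtual crossings.
\<close>

record vdiagram =
  curve :: "real \<Rightarrow> complex"
  overs :: "real set"

definition velocity :: "vdiagram \<Rightarrow> real \<Rightarrow> complex" where
  "velocity K u = vector_derivative (curve K) (at u)"

text \<open>The determinant of a pair of plane vectors; positive iff \<open>w\<close> points to the left of \<open>v\<close>.\<close>

definition wedge :: "complex \<Rightarrow> complex \<Rightarrow> real" where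
  "wedge v w = Re v * Im w - Im v * Re w"

definition double_params :: "vdiagram \<Rightarrow> real \<Rightarrow> real \<Rightarrow> bool" where
  "double_params K p q \<longleftrightarrow> p - q \<notin> \<int> \<and> curve K p = curve K q"

definition virtual_knot_diagram :: "vdiagram \<Rightarrow> bool" where
  "virtual_knot_diagram K \<longleftrightarrow>
     (\<forall>u. curve K (u + 1) = curve K u) \<and>
     curve K C1_differentiable_on UNIV \<and>
     (\<forall>u. velocity K u \<noteq> 0) \<and>
     finite {p \<in> {0..<1}. \<exists>q. double_params K p q} \<and>
     (\<forall>p q r. double_params K p q \<and> double_params K p r \<longrightarrow> q - r \<in> \<int>) \<and>
     (\<forall>p q. double_params K p q \<longrightarrow> wedge (velocity K p) (velocity K q) \<noteq> 0) \<and>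
     (\<forall>u. u + 1 \<in> overs K \<longleftrightarrow> u \<in> overs K) \<and>
     (\<forall>p \<in> overs K. \<exists>q. double_params K p q) \<and>
     (\<forall>p q. double_params K p q \<longrightarrow> \<not> (p \<in> overs K \<and> q \<in> overs K))"

text \<open>A classical crossing is the pair of its over-parameter and its under-parameter in \<open>[0,1)\<close>.\<close>

definition classical_crossings :: "vdiagram \<Rightarrow> (real \<times> real) set" where
  "classical_crossings K =
     {(p, q). p \<in> {0..<1} \<and> q \<in> {0..<1} \<and> p \<in> overs K \<and> double_params K p q}"

definition classical_params :: "vdiagram \<Rightarrow> real set" where
  "classical_params K = {p. \<exists>q. double_params K p q \<and> (p \<in> overs K \<or> q \<in> overs K)}"


section \<open>Cheng colorings and the affine index polynomial\<close>

text \<open>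
  Arcs are represented by their 1-periodic sets of parameters: the components of the complement of
  the classical crossing parameters, taken modulo \<^term>\<open>\<int> :: real set\<close>.
\<close>

definition arc_through :: "vdiagram \<Rightarrow> real \<Rightarrow> real set" where
  "arc_through K u = {v. \<exists>n\<in>\<int>. connected_component (- classical_params K) u (v + n)}"

definition in_arc :: "vdiagram \<Rightarrow> real \<Rightarrow> real set" where
  "in_arc K p = (THE A. \<forall>\<^sub>F u in at_left p. arc_through K u = A)"

definition out_arc :: "vdiagram \<Rightarrow> real \<Rightarrow> real set" where
  "out_arc K p = (THE A. \<forall>\<^sub>F u in at_right p. arc_through K u = A)"

text \<open>
  When both strands are drawn upward, the left incoming strand is the one going from lower left to
  upper right; the direction of the other strand points to its left.
\<close>

fun left_strand :: "vdiagram \<Rightarrow> real \<times> real \<Rightarrow> real" where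
  "left_strand K (p, q) = (if wedge (velocity K p) (velocity K q) > 0 then p else q)"

fun right_strand :: "vdiagram \<Rightarrow> real \<times> real \<Rightarrow> real" where
  "right_strand K (p, q) = (if wedge (velocity K p) (velocity K q) > 0 then q else p)"

text \<open>Only the values of \<open>f\<close> on the arcs of \<open>K\<close> matter.\<close>

definition cheng_coloring :: "vdiagram \<Rightarrow> (real set \<Rightarrow> int) \<Rightarrow> bool" where
  "cheng_coloring K f \<longleftrightarrow>
     (\<forall>c \<in> classical_crossings K.
        f (out_arc K (left_strand K c)) = f (in_arc K (left_strand K c)) - 1 \<and>
        f (out_arc K (right_strand K c)) = f (in_arc K (right_strand K c)) + 1)"

definition W_plus :: "vdiagram \<Rightarrow> (real set \<Rightarrow> int) \<Rightarrow> real \<times> real \<Rightarrow> int" where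
  "W_plus K f c = (let a = f (in_arc K (left_strand K c)); b = f (in_arc K (right_strand K c))
                   in a - (b + 1))"

definition W_minus :: "vdiagram \<Rightarrow> (real set \<Rightarrow> int) \<Rightarrow> real \<times> real \<Rightarrow> int" where
  "W_minus K f c = (let a = f (in_arc K (left_strand K c)); b = f (in_arc K (right_strand K c))
                    in b - (a - 1))"

definition crossing_sign :: "vdiagram \<Rightarrow> real \<times> real \<Rightarrow> int" where
  "crossing_sign K c = (if left_strand K c = fst c then 1 else - 1)"

definition weight :: "vdiagram \<Rightarrow> real \<times> real \<Rightarrow> int" where
  "weight K c = (let f = (SOME f. cheng_coloring K f)
                 in if crossing_sign K c = 1 then W_plus K f c else W_minus K f c)"

text \<open>The group ring of the additive group of integers is the ring of integral Laurent polynomials.\<close>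

type_synonym laurent_poly = "int \<Rightarrow>\<^sub>0 int"

definition t_power :: "int \<Rightarrow> laurent_poly" where
  "t_power k = Poly_Mapping.single k 1"

definition affine_index_polynomial :: "vdiagram \<Rightarrow> laurent_poly" where
  "affine_index_polynomial K =
     (\<Sum>c \<in> classical_crossings K. of_int (crossing_sign K c) * (t_power (weight K c) - 1))"


section \<open>Planar isotopy and change of parametrisation\<close>

definition C1_diffeo :: "(complex \<Rightarrow> complex) \<Rightarrow> (complex \<Rightarrow> complex \<Rightarrow> complex) \<Rightarrow> bool" where
  "C1_diffeo h h' \<longleftrightarrow>
     bij h \<and> (\<forall>z. (h has_derivative h' z) (at z)) \<and>
     (\<forall>v. continuous_on UNIV (\<lambda>z. h' z v)) \<and> (\<forall>z. wedge (h' z 1) (h' z \<i>) \<noteq> 0)"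

definition orientation_preserving_diffeo :: "(complex \<Rightarrow> complex) \<Rightarrow> bool" where
  "orientation_preserving_diffeo h \<longleftrightarrow>
     (\<exists>h'. C1_diffeo h h' \<and> (\<forall>z. wedge (h' z 1) (h' z \<i>) > 0))"

definition ambient_isotopy :: "(real \<Rightarrow> complex \<Rightarrow> complex) \<Rightarrow> bool" where
  "ambient_isotopy H \<longleftrightarrow>
     H 0 = id \<and> continuous_on ({0..1} \<times> UNIV) (\<lambda>(s, z). H s z) \<and>
     (\<exists>H'. (\<forall>s\<in>{0..1}. C1_diffeo (H s) (H' s)) \<and>
           (\<forall>v. continuous_on ({0..1} \<times> UNIV) (\<lambda>(s, z). H' s z v)))"

definition planar_isotopic :: "vdiagram \<Rightarrow> vdiagram \<Rightarrow> bool" where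
  "planar_isotopic K K' \<longleftrightarrow>
     (\<exists>H. ambient_isotopy H \<and> curve K' = H 1 \<circ> curve K \<and> overs K' = overs K)"

definition reparametrized :: "vdiagram \<Rightarrow> vdiagram \<Rightarrow> bool" where
  "reparametrized K K' \<longleftrightarrow>
     (\<exists>\<phi> \<phi>'. (\<forall>u. (\<phi> has_real_derivative \<phi>' u) (at u)) \<and> continuous_on UNIV \<phi>' \<and>
        (\<forall>u. \<phi>' u > 0) \<and> (\<forall>u. \<phi> (u + 1) = \<phi> u + 1) \<and>
        curve K' = curve K \<circ> \<phi> \<and> overs K' = \<phi> -` overs K)"


section \<open>Reidemeister moves\<close>

text \<open>
  A classical move replaces, inside the image of the square \<open>[-1,1] \<times> [-1,1]\<close> under an orientation
  preserving diffeomorphism \<open>h\<close> of the plane, one standard picture by another. A picture consists of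
  \<open>n\<close> strands \<open>M 0, \<dots>, M (n - 1)\<close>, each parametrised by \<open>[-1,1]\<close>. The \<open>i\<close>th strand is run through by
  the parameters \<open>c i + r i * t\<close> of the diagram. The sign of \<open>r i\<close> says whether the diagram follows
  the strand forward or backward, so all orientations of the pictures are covered.
\<close>

definition strand_params :: "nat \<Rightarrow> (nat \<Rightarrow> real) \<Rightarrow> (nat \<Rightarrow> real) \<Rightarrow> real set" where
  "strand_params n c r = {c i + r i * t + k | i t k. i < n \<and> t \<in> {-1..1} \<and> k \<in> \<int>}"

definition looks_like ::
  "vdiagram \<Rightarrow> (complex \<Rightarrow> complex) \<Rightarrow> nat \<Rightarrow> (nat \<Rightarrow> real \<Rightarrow> complex) \<Rightarrow>
   (nat \<Rightarrow> real) \<Rightarrow> (nat \<Rightarrow> real) \<Rightarrow> bool" where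
  "looks_like K h n M c r \<longleftrightarrow>
     (\<forall>i<n. r i \<noteq> 0) \<and>
     (\<forall>i<n. \<forall>t\<in>{-1..1}. curve K (c i + r i * t) = h (M i t)) \<and>
     (\<forall>u. curve K u \<in> h ` cbox (Complex (- 1) (- 1)) (Complex 1 1) \<longrightarrow> u \<in> strand_params n c r)"

definition local_move ::
  "vdiagram \<Rightarrow> vdiagram \<Rightarrow> nat \<Rightarrow> (nat \<Rightarrow> real \<Rightarrow> complex) \<Rightarrow> (nat \<Rightarrow> real \<Rightarrow> complex) \<Rightarrow>
   (nat \<Rightarrow> real) \<Rightarrow> (nat \<Rightarrow> real) \<Rightarrow> bool" where
  "local_move K K' n M M' c r \<longleftrightarrow>
     (\<exists>h. orientation_preserving_diffeo h \<and> looks_like K h n M c r \<and> looks_like K' h n M' c r) \<and>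
     (\<forall>u. u \<notin> strand_params n c r \<longrightarrow>
        curve K' u = curve K u \<and> (u \<in> overs K' \<longleftrightarrow> u \<in> overs K))"

text \<open>All crossings of distinct strands are classical, and \<open>ht\<close> says which strand is above which.\<close>

definition layered ::
  "vdiagram \<Rightarrow> nat \<Rightarrow> (nat \<Rightarrow> real \<Rightarrow> complex) \<Rightarrow> (nat \<Rightarrow> real) \<Rightarrow> (nat \<Rightarrow> real) \<Rightarrow>
   (nat \<Rightarrow> nat) \<Rightarrow> bool" where
  "layered K n M c r ht \<longleftrightarrow>
     (\<forall>i<n. \<forall>j<n. \<forall>s\<in>{-1..1}. \<forall>t\<in>{-1..1}. i \<noteq> j \<and> M i s = M j t \<longrightarrow>
        (c i + r i * s \<in> overs K \<longleftrightarrow> ht j < ht i))"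

text \<open>
  The two pictures of each move agree to first order at the ends of the strands. The only crossing
  of \<open>R1_kink\<close> is its self-crossing at \<open>(0, 1/8)\<close>.
\<close>

definition R1_kink :: "nat \<Rightarrow> real \<Rightarrow> complex" where
  "R1_kink i t = Complex (t - 4 * t * (1 - t\<^sup>2)\<^sup>2) ((1 - t\<^sup>2)\<^sup>2 / 2)"

definition R1_flat :: "nat \<Rightarrow> real \<Rightarrow> complex" where
  "R1_flat i t = Complex t 0"

definition reidemeister1 :: "vdiagram \<Rightarrow> vdiagram \<Rightarrow> bool" where
  "reidemeister1 K K' \<longleftrightarrow>
     (\<exists>c r. local_move K K' 1 R1_kink R1_flat c r \<and> (\<exists>t\<in>{-1..1}. c 0 + r 0 * t \<in> overs K))"

definition R2_crossing :: "nat \<Rightarrow> real \<Rightarrow> complex" where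
  "R2_crossing i t = (if i = 0 then Complex t (1/2 - (1 - t\<^sup>2)\<^sup>2)
                      else Complex t ((1 - t\<^sup>2)\<^sup>2 - 1/2))"

definition R2_parallel :: "nat \<Rightarrow> real \<Rightarrow> complex" where
  "R2_parallel i t = (if i = 0 then Complex t (1/2) else Complex t (- 1/2))"

definition reidemeister2 :: "vdiagram \<Rightarrow> vdiagram \<Rightarrow> bool" where
  "reidemeister2 K K' \<longleftrightarrow>
     (\<exists>c r ht. local_move K K' 2 R2_crossing R2_parallel c r \<and> inj_on ht {..<2} \<and>
               layered K 2 R2_crossing c r ht)"

definition R3_above :: "nat \<Rightarrow> real \<Rightarrow> complex" where
  "R3_above i t = (if i = 0 then Complex t t else if i = 1 then Complex t (- t)
                   else Complex t ((1 - t\<^sup>2)\<^sup>2 / 2))"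

definition R3_below :: "nat \<Rightarrow> real \<Rightarrow> complex" where
  "R3_below i t = (if i = 0 then Complex t t else if i = 1 then Complex t (- t)
                   else Complex t (- ((1 - t\<^sup>2)\<^sup>2 / 2)))"

definition reidemeister3 :: "vdiagram \<Rightarrow> vdiagram \<Rightarrow> bool" where
  "reidemeister3 K K' \<longleftrightarrow>
     (\<exists>c r ht. local_move K K' 3 R3_above R3_below c r \<and> inj_on ht {..<3} \<and>
               layered K 3 R3_above c r ht \<and> layered K' 3 R3_below c r ht)"


section \<open>The detour move and virtual isotopy\<close>

definition detour :: "vdiagram \<Rightarrow> vdiagram \<Rightarrow> bool" where
  "detour K K' \<longleftrightarrow>
     (\<exists>a b. a < b \<and> b < a + 1 \<and>
        (let E = {u + k | u k. u \<in> {a..b} \<and> k \<in> \<int>} in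
           (\<forall>u. u \<notin> E \<longrightarrow> curve K' u = curve K u) \<and> overs K' = overs K \<and>
           E \<inter> classical_params K = {} \<and> E \<inter> classical_params K' = {}))"

definition virtual_isotopy_step :: "vdiagram \<Rightarrow> vdiagram \<Rightarrow> bool" where
  "virtual_isotopy_step K K' \<longleftrightarrow>
     virtual_knot_diagram K \<and> virtual_knot_diagram K' \<and>
     (planar_isotopic K K' \<or> reparametrized K K' \<or>
      reidemeister1 K K' \<or> reidemeister2 K K' \<or> reidemeister3 K K' \<or> detour K K')"

definition virtually_isotopic :: "vdiagram \<Rightarrow> vdiagram \<Rightarrow> bool" where
  "virtually_isotopic = equivclp virtual_isotopy_step"

definition oriented_virtual_knot :: "vdiagram \<Rightarrow> vdiagram set" where
  "oriented_virtual_knot K = {K'. virtual_knot_diagram K' \<and> virtually_isotopic K K'}"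

end

theory Submission
  imports Defs
begin

text \<open>
  The weight of a crossing only depends on the Gauss diagram. Minus the Cheng coloring jumps by the
  sign of the crossing at an over-parameter and by minus the sign at an under-parameter. With a
  representative \<open>(p, q)\<close> of the over- and the under-parameter chosen for every crossing, it is
  therefore, up to a constant, the sum of \<open>sgn * (\<lceil>x - p\<rceil> - \<lceil>x - q\<rceil>)\<close> over all crossings, which is
  1-periodic in \<open>x\<close>. Changing representatives by integers adds a constant to this sum, so the
  polynomial can be computed from any set of representatives.

  A Reidemeister move changes the Gauss diagram only inside the parameter intervals of its strands.
  As seen from any other parameter, all points of one interval contribute equally to the sum. So
  the crossing of a kink has weight 0, the two crossings of a bigon have equal weights and opposite
  signs, and in a triangle the two changes in the weight of each crossing cancel.
\<close>

section \<open>Gauss diagrams\<close>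

text \<open>The ceiling is chosen because it is left-continuous: its value at a crossing parameter
  belongs to the incoming arc, whose label is the one that enters the weights. A single ceiling is
  not periodic, but each crossing contributes two of them with opposite factors, so a full turn
  changes nothing. Two obstacles shape the rest. Crossings are recorded by parameters in
  \<open>[0,1)\<close>, while a strand of a move, or a change of parametrisation, may run across an
  integer; with free representatives each strand stays one interval of the real line, to which
  convexity applies. And a local picture does not say that its strands use disjoint parameters of
  the circle; this has to be extracted from the pictures of the move.\<close>

definition level :: "(real \<times> real \<Rightarrow> int) \<Rightarrow> (real \<times> real) set \<Rightarrow> real \<Rightarrow> int" where
  "level e X x = (\<Sum>c\<in>X. e c * (\<lceil>x - fst c\<rceil> - \<lceil>x - snd c\<rceil>))"

text \<open>Both weights at once. With labels equal to a constant minus \<open>level\<close>, the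
  first two terms are the incoming over-label minus the incoming under-label. For sign 1 the
  over-strand comes from the left, which gives \<open>a - (b + 1)\<close>; for sign -1 it comes from
  the right, which gives \<open>b - (a - 1)\<close>.\<close>

definition gauss_weight :: "(real \<times> real \<Rightarrow> int) \<Rightarrow> (real \<times> real) set \<Rightarrow> real \<times> real \<Rightarrow> int" where
  "gauss_weight e X c = level e X (snd c) - level e X (fst c) - e c"

definition gauss_poly :: "(real \<times> real \<Rightarrow> int) \<Rightarrow> (real \<times> real) set \<Rightarrow> laurent_poly" where
  "gauss_poly e X = (\<Sum>c\<in>X. of_int (e c) * (t_power (gauss_weight e X c) - 1))"

definition avoids :: "(real \<times> real) set \<Rightarrow> real set \<Rightarrow> bool" where
  "avoids Y A \<longleftrightarrow> (\<forall>c\<in>Y. \<forall>a\<in>A. a - fst c \<notin> \<int> \<and> a - snd c \<notin> \<int>)"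

section \<open>Ceilings of differences along intervals\<close>

lemma ceiling_eq_if_no_Ints_between:
  fixes a b :: real
  assumes "\<And>x. x \<in> closed_segment a b \<Longrightarrow> x \<notin> \<int>"
  shows "\<lceil>a\<rceil> = \<lceil>b\<rceil>"
proof -
  have *: "\<lceil>a\<rceil> = \<lceil>b\<rceil>" if "a \<le> b" "\<And>x. x \<in> {a..b} \<Longrightarrow> x \<notin> \<int>" for a b :: real
  proof (rule ccontr)
    assume "\<lceil>a\<rceil> \<noteq> \<lceil>b\<rceil>"
    then have "\<lceil>a\<rceil> < \<lceil>b\<rceil>" using ceiling_mono[OF that(1)] by linarith
    then have "real_of_int \<lceil>a\<rceil> \<in> {a..b}"
      using less_ceiling_iff[of "\<lceil>a\<rceil>" b] by auto
    then show False using that(2) Ints_of_int by blast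
  qed
  show ?thesis
  proof (cases "a \<le> b")
    case True
    then show ?thesis using *[OF True] assms by (simp add: closed_segment_eq_real_ivl)
  next
    case False
    then have "\<lceil>b\<rceil> = \<lceil>a\<rceil>" by (intro *) (use assms in \<open>auto simp: closed_segment_eq_real_ivl\<close>)
    then show ?thesis by simp
  qed
qed

text \<open>By convexity every point of the segment from \<open>a - b\<close> to
  \<open>a' - b'\<close> is a difference of a point of \<open>A\<close> and a point of
  \<open>B\<close>, so no integer is met on the way. This is what makes all points of a strand look
  alike from another strand.\<close>

lemma ceiling_diff_cong:
  fixes a b :: real
  assumes "convex A" "convex B" "\<And>x y. x \<in> A \<Longrightarrow> y \<in> B \<Longrightarrow> x - y \<notin> \<int>"
    and "a \<in> A" "a' \<in> A" "b \<in> B" "b' \<in> B"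
  shows "\<lceil>a - b\<rceil> = \<lceil>a' - b'\<rceil>"
proof (rule ceiling_eq_if_no_Ints_between)
  fix x assume "x \<in> closed_segment (a - b) (a' - b')"
  then obtain u where u: "0 \<le> u" "u \<le> 1" "x = (1 - u) *\<^sub>R (a - b) + u *\<^sub>R (a' - b')"
    by (auto simp: in_segment)
  have "(1 - u) *\<^sub>R a + u *\<^sub>R a' \<in> A" "(1 - u) *\<^sub>R b + u *\<^sub>R b' \<in> B"
    using convexD[OF assms(1) assms(4,5), of "1 - u" u] convexD[OF assms(2) assms(6,7), of "1 - u" u] u
    by simp_all
  moreover have "x = ((1 - u) *\<^sub>R a + u *\<^sub>R a') - ((1 - u) *\<^sub>R b + u *\<^sub>R b')"
    using u by (simp add: algebra_simps)
  ultimately show "x \<notin> \<int>" using assms(3) by metis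
qed

lemma ceiling_add_ceiling_minus:
  fixes x :: real
  assumes "x \<notin> \<int>"
  shows "\<lceil>x\<rceil> + \<lceil>- x\<rceil> = 1"
proof -
  have "x - of_int \<lfloor>x\<rfloor> \<noteq> 0" using assms frac_eq_0_iff[of x] unfolding frac_def by blast
  then have "\<lceil>x\<rceil> = \<lfloor>x\<rfloor> + 1" unfolding ceiling_altdef by (metis eq_iff_diff_eq_0)
  then show ?thesis by (simp add: ceiling_minus)
qed

lemma ceiling_diff_swap:
  fixes x y :: real
  assumes "x - y \<notin> \<int>"
  shows "\<lceil>y - x\<rceil> = 1 - \<lceil>x - y\<rceil>"
  using ceiling_add_ceiling_minus[OF assms] by simp

lemma level_insert:
  "finite X \<Longrightarrow> c \<notin> X \<Longrightarrow>
     level e (insert c X) x = e c * (\<lceil>x - fst c\<rceil> - \<lceil>x - snd c\<rceil>) + level e X x"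
  by (simp add: level_def)

text \<open>An integer shift adds the same amount to both ceilings of each summand.\<close>

lemma level_cong_Ints:
  assumes "x - y \<in> \<int>"
  shows "level e X x = level e X y"
proof -
  obtain k :: int where k: "x = y + of_int k"
    using assms by (metis Ints_cases add.commute diff_add_cancel)
  have "\<lceil>x - a\<rceil> = \<lceil>y - a\<rceil> + k" for a
    using ceiling_add_of_int[of "y - a" k] unfolding k by (simp add: algebra_simps)
  then show ?thesis unfolding level_def by simp
qed

lemma level_cong_avoids:
  assumes "convex A" "x \<in> A" "y \<in> A" "avoids Y A"
  shows "level e Y x = level e Y y"
  unfolding level_def
proof (rule sum.cong[OF refl])
  fix c assume c: "c \<in> Y"
  have "\<lceil>x - fst c\<rceil> = \<lceil>y - fst c\<rceil>"
    by (rule ceiling_diff_cong[of A "{fst c}"]) (use assms c in \<open>auto simp: avoids_def\<close>)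
  moreover have "\<lceil>x - snd c\<rceil> = \<lceil>y - snd c\<rceil>"
    by (rule ceiling_diff_cong[of A "{snd c}"]) (use assms c in \<open>auto simp: avoids_def\<close>)
  ultimately show "e c * (\<lceil>x - fst c\<rceil> - \<lceil>x - snd c\<rceil>) = e c * (\<lceil>y - fst c\<rceil> - \<lceil>y - snd c\<rceil>)"
    by simp
qed

lemma diff_in_Ints_commute: "y - x \<in> \<int> \<longleftrightarrow> x - y \<in> \<int>" for x y :: real
  using minus_in_Ints_iff[of "x - y"] by simp

lemma avoidsD:
  assumes "avoids Y A" "c \<in> Y" "a \<in> A"
  shows "a - fst c \<notin> \<int>" "a - snd c \<notin> \<int>" "fst c - a \<notin> \<int>" "snd c - a \<notin> \<int>"
  using assms diff_in_Ints_commute unfolding avoids_def by blast+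

lemma ceiling_diff_avoids:
  assumes "avoids Y A" "convex A" "c \<in> Y" "a \<in> A" "a' \<in> A"
  shows "\<lceil>fst c - a\<rceil> = \<lceil>fst c - a'\<rceil>" "\<lceil>snd c - a\<rceil> = \<lceil>snd c - a'\<rceil>"
proof -
  show "\<lceil>fst c - a\<rceil> = \<lceil>fst c - a'\<rceil>"
    by (rule ceiling_diff_cong[of "{fst c}" A]) (use assms avoidsD[of Y A c] in auto)
  show "\<lceil>snd c - a\<rceil> = \<lceil>snd c - a'\<rceil>"
    by (rule ceiling_diff_cong[of "{snd c}" A]) (use assms avoidsD[of Y A c] in auto)
qed

section \<open>Invariance of the polynomial of a Gauss diagram\<close>

lemma gauss_poly_bij:
  assumes bij: "bij_betw f X X'"
    and e: "\<And>c. c \<in> X \<Longrightarrow> e' (f c) = e c"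
    and l: "\<And>c. c \<in> X \<Longrightarrow> level e' X' (fst (f c)) = level e X (fst c) + k \<and>
                            level e' X' (snd (f c)) = level e X (snd c) + k"
  shows "gauss_poly e' X' = gauss_poly e X"
proof -
  have "gauss_poly e' X' = (\<Sum>c\<in>X. of_int (e' (f c)) * (t_power (gauss_weight e' X' (f c)) - 1))"
    unfolding gauss_poly_def by (rule sum.reindex_bij_betw[OF bij, symmetric])
  \<comment> \<open>Weights are differences of levels, so the common shift \<open>k\<close>
    cancels.\<close>
  also have "\<dots> = gauss_poly e X"
    unfolding gauss_poly_def by (rule sum.cong) (simp_all add: e l gauss_weight_def)
  finally show ?thesis .
qed

lemma gauss_poly_cong:
  assumes "\<And>c. c \<in> X \<Longrightarrow> e' c = e c"
  shows "gauss_poly e' X = gauss_poly e X"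
proof -
  have "level e' X x = level e X x" for x
    unfolding level_def using assms by (intro sum.cong) auto
  then show ?thesis using assms by (intro gauss_poly_bij[of id _ _ _ _ 0]) auto
qed

text \<open>Seen from the ends of any other chord, \<open>p\<close> and \<open>q\<close> have equal
  ceilings, so the old weights do not change. Between the ends of the new chord its own summand
  makes a difference of \<open>e * (\<lceil>q - p\<rceil> + \<lceil>p - q\<rceil>) = e\<close>,
  which the last term of the weight cancels.\<close>

lemma gauss_poly_kink:
  assumes Y: "finite Y" "(p, q) \<notin> Y" "avoids Y A" "convex A" and pq: "p \<in> A" "q \<in> A" "p - q \<notin> \<int>"
  shows "gauss_poly e (insert (p, q) Y) = gauss_poly e Y"
proof -
  let ?X = "insert (p, q) Y"
  have L: "level e ?X x = e (p, q) * (\<lceil>x - p\<rceil> - \<lceil>x - q\<rceil>) + level e Y x" for x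
    using Y by (simp add: level_insert)
  have "gauss_weight e ?X c = gauss_weight e Y c" if "c \<in> Y" for c
    using ceiling_diff_avoids[OF Y(3,4) that pq(1,2)] by (simp add: gauss_weight_def L)
  moreover have "level e Y p = level e Y q" using level_cong_avoids Y pq by blast
  then have "gauss_weight e ?X (p, q) = 0"
    by (simp add: gauss_weight_def L ceiling_diff_swap[OF pq(3)] algebra_simps)
  ultimately show ?thesis
    using Y by (simp add: gauss_poly_def t_power_def)
qed

text \<open>With \<open>e\<close> the sign of \<open>(p, q)\<close>, the weight of
  \<open>(p, q)\<close> is, up to a term common to both chords,
  \<open>e * (\<lceil>p - p'\<rceil> + \<lceil>q - q'\<rceil> - 1)\<close>. Exchanging the chords
  replaces \<open>e\<close> by \<open>- e\<close> and the sum of the two ceilings by 2 minus that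
  sum, so the value stays. Which of \<open>p\<close>, \<open>p'\<close> and which of
  \<open>q\<close>, \<open>q'\<close> comes first is left open; this covers both relative directions
  of the strands.\<close>

lemma gauss_poly_bigon:
  assumes Y: "finite Y" "avoids Y A" "avoids Y B" "convex A" "convex B"
    and AB: "\<And>x y. x \<in> A \<Longrightarrow> y \<in> B \<Longrightarrow> x - y \<notin> \<int>"
    and pq: "p \<in> A" "p' \<in> A" "q \<in> B" "q' \<in> B" "p - p' \<notin> \<int>" "q - q' \<notin> \<int>"
    and e: "e (p', q') = - e (p, q)"
  shows "gauss_poly e ({(p, q), (p', q')} \<union> Y) = gauss_poly e Y"
proof -
  let ?X = "insert (p, q) (insert (p', q') Y)"
  have nin: "(p, q) \<notin> Y" "(p', q') \<notin> Y"
    using avoidsD(1)[OF Y(2) _ pq(1), of "(p, q)"] avoidsD(1)[OF Y(2) _ pq(2), of "(p', q')"] by auto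
  have ne: "p \<noteq> p'" using pq by auto
  have L: "level e ?X x = e (p, q) * (\<lceil>x - p\<rceil> - \<lceil>x - q\<rceil> - \<lceil>x - p'\<rceil> + \<lceil>x - q'\<rceil>) + level e Y x" for x
    using Y nin ne by (simp add: level_insert e algebra_simps)
  have Yw: "gauss_weight e ?X c = gauss_weight e Y c" if "c \<in> Y" for c
    using ceiling_diff_avoids[OF Y(2,4) that pq(1,2)] ceiling_diff_avoids[OF Y(3,5) that pq(3,4)]
    by (simp add: gauss_weight_def L)
  have BA: "y - x \<notin> \<int>" if "x \<in> A" "y \<in> B" for x y
    using AB[OF that] by (simp add: diff_in_Ints_commute)
  have "level e Y p = level e Y p'" "level e Y q = level e Y q'" using level_cong_avoids Y pq by blast+
  moreover have "\<lceil>p - q\<rceil> = \<lceil>p' - q'\<rceil>" "\<lceil>p - q'\<rceil> = \<lceil>p' - q'\<rceil>" "\<lceil>p' - q\<rceil> = \<lceil>p' - q'\<rceil>"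
    using ceiling_diff_cong[OF Y(4,5) AB] pq by blast+
  moreover have "\<lceil>q - p\<rceil> = \<lceil>q' - p'\<rceil>" "\<lceil>q - p'\<rceil> = \<lceil>q' - p'\<rceil>" "\<lceil>q' - p\<rceil> = \<lceil>q' - p'\<rceil>"
    using ceiling_diff_cong[OF Y(5,4) BA] pq by blast+
  ultimately have "gauss_weight e ?X (p', q') = gauss_weight e ?X (p, q)"
    by (simp add: gauss_weight_def L e ceiling_diff_swap[OF pq(5)] ceiling_diff_swap[OF pq(6)] algebra_simps)
  then have "gauss_poly e ?X = gauss_poly e Y"
    using Y nin ne Yw by (simp add: gauss_poly_def e)
  then show ?thesis by simp
qed

text \<open>Strand \<open>A\<close> passes over strands \<open>B\<close> and \<open>C\<close>, and \<open>B\<close> over \<open>C\<close>. The move reverses the order of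
  the two crossings on each strand.\<close>

lemma gauss_poly_triangle:
  assumes Y: "finite Y" "avoids Y A" "avoids Y B" "avoids Y C" "convex A" "convex B" "convex C"
    and dis: "\<And>x y. x \<in> A \<Longrightarrow> y \<in> B \<Longrightarrow> x - y \<notin> \<int>" "\<And>x y. x \<in> A \<Longrightarrow> y \<in> C \<Longrightarrow> x - y \<notin> \<int>"
      "\<And>x y. x \<in> B \<Longrightarrow> y \<in> C \<Longrightarrow> x - y \<notin> \<int>"
    and eY: "\<And>c. c \<in> Y \<Longrightarrow> e' c = e c"
    and A: "a1 \<in> A" "a2 \<in> A" "a1' \<in> A" "a2' \<in> A"
    and B: "b1 \<in> B" "b2 \<in> B" "b1' \<in> B" "b2' \<in> B"
    and C: "c1 \<in> C" "c2 \<in> C" "c1' \<in> C" "c2' \<in> C"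
    and ord: "\<lceil>a1 - a2\<rceil> = \<alpha>" "\<lceil>a2 - a1\<rceil> = 1 - \<alpha>" "\<lceil>a1' - a2'\<rceil> = 1 - \<alpha>" "\<lceil>a2' - a1'\<rceil> = \<alpha>"
      "\<lceil>b1 - b2\<rceil> = \<beta>" "\<lceil>b2 - b1\<rceil> = 1 - \<beta>" "\<lceil>b1' - b2'\<rceil> = 1 - \<beta>" "\<lceil>b2' - b1'\<rceil> = \<beta>"
      "\<lceil>c1 - c2\<rceil> = \<gamma>" "\<lceil>c2 - c1\<rceil> = 1 - \<gamma>" "\<lceil>c1' - c2'\<rceil> = 1 - \<gamma>" "\<lceil>c2' - c1'\<rceil> = \<gamma>"
    and e: "e (a1, b1) = s" "e' (a1', b1') = s" "e (a2, c1) = t" "e' (a2', c1') = t"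
      "e (b2, c2) = w" "e' (b2', c2') = w"
    and tri: "t * (1 - 2 * \<alpha>) = w * (1 - 2 * \<beta>)" "s * (1 - 2 * \<alpha>) = w * (1 - 2 * \<gamma>)"
      "s * (1 - 2 * \<beta>) = t * (1 - 2 * \<gamma>)"
  shows "gauss_poly e ({(a1, b1), (a2, c1), (b2, c2)} \<union> Y) =
         gauss_poly e' ({(a1', b1'), (a2', c1'), (b2', c2')} \<union> Y)"
proof -
  let ?X = "insert (a1, b1) (insert (a2, c1) (insert (b2, c2) Y))"
  let ?X' = "insert (a1', b1') (insert (a2', c1') (insert (b2', c2') Y))"
  have nin: "(a1, b1) \<notin> Y" "(a2, c1) \<notin> Y" "(b2, c2) \<notin> Y"
       "(a1', b1') \<notin> Y" "(a2', c1') \<notin> Y" "(b2', c2') \<notin> Y"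
    using avoidsD(1)[OF Y(2) _ A(1), of "(a1, b1)"] avoidsD(1)[OF Y(2) _ A(2), of "(a2, c1)"]
      avoidsD(1)[OF Y(3) _ B(2), of "(b2, c2)"]
      avoidsD(1)[OF Y(2) _ A(3), of "(a1', b1')"] avoidsD(1)[OF Y(2) _ A(4), of "(a2', c1')"]
      avoidsD(1)[OF Y(3) _ B(4), of "(b2', c2')"]
    by auto
  have ne: "a \<noteq> b" if "a \<in> A" "b \<in> B" for a b using dis(1)[OF that] by auto
  have ne2: "(a1, b1) \<noteq> (a2, c1)" "(a1', b1') \<noteq> (a2', c1')"
    using dis(3)[OF B(1) C(1)] dis(3)[OF B(3) C(3)] by auto
  have L: "level e ?X x = s * (\<lceil>x - a1\<rceil> - \<lceil>x - b1\<rceil>) + t * (\<lceil>x - a2\<rceil> - \<lceil>x - c1\<rceil>)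
             + w * (\<lceil>x - b2\<rceil> - \<lceil>x - c2\<rceil>) + level e Y x" for x
    using Y nin ne2 ne A B C by (simp add: level_insert e algebra_simps)
  have LY: "level e' Y x = level e Y x" for x
    unfolding level_def using eY by (intro sum.cong) auto
  have L': "level e' ?X' x = s * (\<lceil>x - a1'\<rceil> - \<lceil>x - b1'\<rceil>) + t * (\<lceil>x - a2'\<rceil> - \<lceil>x - c1'\<rceil>)
             + w * (\<lceil>x - b2'\<rceil> - \<lceil>x - c2'\<rceil>) + level e Y x" for x
    using Y nin ne2 ne A B C by (simp add: level_insert e LY algebra_simps)
  have Yw: "gauss_weight e' ?X' c = gauss_weight e ?X c" if "c \<in> Y" for c
    using ceiling_diff_avoids[OF Y(2,5) that A(1,3)] ceiling_diff_avoids[OF Y(2,5) that A(2,4)]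
      ceiling_diff_avoids[OF Y(3,6) that B(1,3)] ceiling_diff_avoids[OF Y(3,6) that B(2,4)]
      ceiling_diff_avoids[OF Y(4,7) that C(1,3)] ceiling_diff_avoids[OF Y(4,7) that C(2,4)]
    by (simp add: gauss_weight_def L L' eY[OF that])
  have dis': "y - x \<notin> \<int>" if "x - y \<notin> \<int>" for x y :: real
    using that by (simp add: diff_in_Ints_commute)
  have AB: "\<lceil>x - y\<rceil> = \<lceil>a1 - b1\<rceil>" "\<lceil>y - x\<rceil> = \<lceil>b1 - a1\<rceil>" if "x \<in> A" "y \<in> B" for x y
    using ceiling_diff_cong[OF Y(5,6) dis(1)] ceiling_diff_cong[OF Y(6,5) dis'[OF dis(1)]] that A B
    by blast+
  have AC: "\<lceil>x - y\<rceil> = \<lceil>a1 - c1\<rceil>" "\<lceil>y - x\<rceil> = \<lceil>c1 - a1\<rceil>" if "x \<in> A" "y \<in> C" for x y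
    using ceiling_diff_cong[OF Y(5,7) dis(2)] ceiling_diff_cong[OF Y(7,5) dis'[OF dis(2)]] that A C
    by blast+
  have BC: "\<lceil>x - y\<rceil> = \<lceil>b1 - c1\<rceil>" "\<lceil>y - x\<rceil> = \<lceil>c1 - b1\<rceil>" if "x \<in> B" "y \<in> C" for x y
    using ceiling_diff_cong[OF Y(6,7) dis(3)] ceiling_diff_cong[OF Y(7,6) dis'[OF dis(3)]] that B C
    by blast+
  have Y1: "level e Y x = level e Y a1" if "x \<in> A" for x using level_cong_avoids Y A that by blast
  have Y2: "level e Y x = level e Y b1" if "x \<in> B" for x using level_cong_avoids Y B that by blast
  have Y3: "level e Y x = level e Y c1" if "x \<in> C" for x using level_cong_avoids Y C that by blast
  note vals = Y1[OF A(2)] Y1[OF A(3)] Y1[OF A(4)] Y2[OF B(2)] Y2[OF B(3)] Y2[OF B(4)]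
    Y3[OF C(2)] Y3[OF C(3)] Y3[OF C(4)]
  \<comment> \<open>Ceilings between points of different strands depend only on the two strands,
    before as well as after the move; six numbers describe them all.\<close>
  have crs: "\<forall>x\<in>{a1,a2,a1',a2'}. \<forall>y\<in>{b1,b2,b1',b2'}. \<lceil>x - y\<rceil> = \<lceil>a1 - b1\<rceil> \<and> \<lceil>y - x\<rceil> = \<lceil>b1 - a1\<rceil>"
    "\<forall>x\<in>{a1,a2,a1',a2'}. \<forall>y\<in>{c1,c2,c1',c2'}. \<lceil>x - y\<rceil> = \<lceil>a1 - c1\<rceil> \<and> \<lceil>y - x\<rceil> = \<lceil>c1 - a1\<rceil>"
    "\<forall>x\<in>{b1,b2,b1',b2'}. \<forall>y\<in>{c1,c2,c1',c2'}. \<lceil>x - y\<rceil> = \<lceil>b1 - c1\<rceil> \<and> \<lceil>y - x\<rceil> = \<lceil>c1 - b1\<rceil>"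
    using A B C by (intro ballI conjI AB AC BC; auto)+
  define k1 k2 k3 k4 k5 k6 where k: "k1 = \<lceil>a1 - b1\<rceil>" "k2 = \<lceil>b1 - a1\<rceil>" "k3 = \<lceil>a1 - c1\<rceil>"
    "k4 = \<lceil>c1 - a1\<rceil>" "k5 = \<lceil>b1 - c1\<rceil>" "k6 = \<lceil>c1 - b1\<rceil>"
  note cr = crs[folded k, simplified]
  \<comment> \<open>What changes is the contribution of the third strand:
    \<open>w * \<beta> - t * \<alpha>\<close> before the move,
    \<open>w * (1 - \<beta>) - t * (1 - \<alpha>)\<close> after it. The first equation of
    \<open>tri\<close> says that these agree; the other two crossings use the other two equations in
    the same way.\<close>
  have w1: "gauss_weight e' ?X' (a1', b1') = gauss_weight e ?X (a1, b1)"
    using tri(1) by (simp add: gauss_weight_def L L' vals cr ord e algebra_simps)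
  have w2: "gauss_weight e' ?X' (a2', c1') = gauss_weight e ?X (a2, c1)"
    using tri(2) by (simp add: gauss_weight_def L L' vals cr ord e algebra_simps)
  have w3: "gauss_weight e' ?X' (b2', c2') = gauss_weight e ?X (b2, c2)"
    using tri(3) by (simp add: gauss_weight_def L L' vals cr ord e algebra_simps)
  have "gauss_poly e ?X = gauss_poly e' ?X'"
    using Y nin ne2 ne A B Yw w1 w2 w3 by (simp add: gauss_poly_def e eY)
  then show ?thesis by simp
qed


section \<open>The Gauss diagram of a virtual knot diagram\<close>

definition csign :: "vdiagram \<Rightarrow> real \<times> real \<Rightarrow> int" where
  "csign K c = (if wedge (velocity K (fst c)) (velocity K (snd c)) > 0 then 1 else - 1)"

text \<open>Representatives may lie anywhere on the line, so that the two ends of a crossing can be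
  taken from prescribed lifts of the strands of a move. Indexing by the over-parameter lists each
  classical crossing once.\<close>

definition gauss_rep :: "vdiagram \<Rightarrow> (real \<times> real) set \<Rightarrow> bool" where
  "gauss_rep K X \<longleftrightarrow> finite X \<and> (\<forall>c\<in>X. fst c \<in> overs K \<and> double_params K (fst c) (snd c)) \<and>
     (\<forall>p\<in>overs K. \<exists>!c. c \<in> X \<and> p - fst c \<in> \<int>)"

lemma diff_frac_Ints: "x - frac x \<in> \<int>" "frac x - x \<in> \<int>" for x :: real
  by (simp_all add: frac_def)

lemma eq_if_diff_Ints:
  fixes x y :: real
  assumes "x - y \<in> \<int>" "x \<in> {0..<1}" "y \<in> {0..<1}"
  shows "x = y"
proof -
  obtain n :: int where n: "x - y = of_int n" using assms(1) by (rule Ints_cases)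
  then have "\<bar>real_of_int n\<bar> < 1" using assms by auto
  then have "n = 0" by linarith
  then show ?thesis using n by simp
qed

lemma Ints_diff_trans: "x - y \<in> \<int> \<Longrightarrow> y - z \<in> \<int> \<Longrightarrow> x - z \<in> \<int>" for x y z :: real
  using Ints_add[of "x - y" "y - z"] by simp

lemma frac_mem: "frac x \<in> {0..<1}" for x :: real
  by (simp add: frac_lt_1)

context
  fixes K assumes K: "virtual_knot_diagram K"
begin

lemma curve_shift: "curve K (u + of_int n) = curve K u"
proof -
  have nat: "curve K (u + real m) = curve K u" for u m
  proof (induction m)
    case (Suc m)
    have "curve K (u + real (Suc m)) = curve K ((u + real m) + 1)" by (simp add: algebra_simps)
    then show ?case using Suc K by (simp add: virtual_knot_diagram_def)
  qed simp
  show ?thesis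
  proof (cases "n \<ge> 0")
    case True
    then show ?thesis using nat[of u "nat n"] by simp
  next
    case False
    then show ?thesis using nat[of "u + of_int n" "nat (- n)"] by simp
  qed
qed

lemma curve_cong_Ints: "u - v \<in> \<int> \<Longrightarrow> curve K u = curve K v"
  by (metis Ints_cases add.commute curve_shift diff_add_cancel)

lemma overs_shift: "u + of_int n \<in> overs K \<longleftrightarrow> u \<in> overs K"
proof -
  have nat: "u + real m \<in> overs K \<longleftrightarrow> u \<in> overs K" for u m
  proof (induction m)
    case (Suc m)
    have "u + real (Suc m) = (u + real m) + 1" by simp
    moreover have "(u + real m) + 1 \<in> overs K \<longleftrightarrow> u + real m \<in> overs K"
      using K unfolding virtual_knot_diagram_def by blast
    ultimately show ?case using Suc by metis
  qed simp
  show ?thesis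
  proof (cases "n \<ge> 0")
    case True
    then show ?thesis using nat[of u "nat n"] by simp
  next
    case False
    then show ?thesis using nat[of "u + of_int n" "nat (- n)"] by simp
  qed
qed

lemma overs_cong_Ints: "u - v \<in> \<int> \<Longrightarrow> u \<in> overs K \<longleftrightarrow> v \<in> overs K"
  by (metis Ints_cases add.commute overs_shift diff_add_cancel)

lemma curve_has_velocity: "(curve K has_vector_derivative velocity K u) (at u)"
proof -
  obtain D where "(curve K has_vector_derivative D) (at u)"
    using K unfolding virtual_knot_diagram_def C1_differentiable_on_def by blast
  then show ?thesis unfolding velocity_def by (simp add: vector_derivative_at)
qed

lemma velocity_cong_Ints:
  assumes "u - v \<in> \<int>"
  shows "velocity K u = velocity K v"
proof -
  have "(curve K \<circ> (\<lambda>x. x + (u - v)) has_vector_derivative 1 *\<^sub>R velocity K u) (at v)"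
    by (rule vector_diff_chain_at)
      (use curve_has_velocity[of u] in \<open>auto intro!: derivative_eq_intros\<close>)
  moreover have "curve K \<circ> (\<lambda>x. x + (u - v)) = curve K"
    using assms by (intro ext) (auto intro: curve_cong_Ints)
  ultimately show ?thesis using curve_has_velocity[of v] vector_derivative_unique_at by fastforce
qed

lemma csign_cong_Ints: "p - p' \<in> \<int> \<Longrightarrow> q - q' \<in> \<int> \<Longrightarrow> csign K (p, q) = csign K (p', q')"
  by (simp add: csign_def velocity_cong_Ints[of p p'] velocity_cong_Ints[of q q'])

lemma double_params_sym: "double_params K p q \<longleftrightarrow> double_params K q p"
  by (auto simp: double_params_def diff_in_Ints_commute[of p q])

lemma double_params_cong_Ints:
  assumes "p - p' \<in> \<int>" "q - q' \<in> \<int>"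
  shows "double_params K p q \<longleftrightarrow> double_params K p' q'"
proof -
  have "p - q \<in> \<int> \<longleftrightarrow> p' - q' \<in> \<int>"
    using assms Ints_diff_trans diff_in_Ints_commute by metis
  then show ?thesis
    using curve_cong_Ints assms by (simp add: double_params_def)
qed

lemma double_params_unique:
  "double_params K p q \<Longrightarrow> double_params K p' q' \<Longrightarrow> p - p' \<in> \<int> \<Longrightarrow> q - q' \<in> \<int>"
  using K double_params_cong_Ints[of p p' q q] unfolding virtual_knot_diagram_def by fastforce

lemma overs_not_both: "p \<in> overs K \<Longrightarrow> double_params K p q \<Longrightarrow> q \<notin> overs K"
  using K unfolding virtual_knot_diagram_def by blast

lemma overs_partner: "p \<in> overs K \<Longrightarrow> \<exists>q. double_params K p q"
  using K unfolding virtual_knot_diagram_def by blast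

lemma gauss_rep_classical_crossings: "gauss_rep K (classical_crossings K)"
  unfolding gauss_rep_def
proof (intro conjI ballI)
  let ?F = "{p \<in> {0..<1}. \<exists>q. double_params K p q}"
  have "classical_crossings K \<subseteq> ?F \<times> ?F"
    unfolding classical_crossings_def using double_params_sym by blast
  moreover have "finite ?F" using K unfolding virtual_knot_diagram_def by blast
  ultimately show "finite (classical_crossings K)" using finite_subset by blast
next
  fix p assume p: "p \<in> overs K"
  then obtain q where q: "double_params K p q" using overs_partner by blast
  have "frac p \<in> overs K" "double_params K (frac p) (frac q)"
    using overs_cong_Ints double_params_cong_Ints diff_frac_Ints p q by blast+
  then have 1: "(frac p, frac q) \<in> classical_crossings K"
    unfolding classical_crossings_def using frac_mem by auto
  show "\<exists>!c. c \<in> classical_crossings K \<and> p - fst c \<in> \<int>"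
  proof (rule ex1I)
    show "(frac p, frac q) \<in> classical_crossings K \<and> p - fst (frac p, frac q) \<in> \<int>"
      using 1 diff_frac_Ints by simp
  next
    fix c assume c: "c \<in> classical_crossings K \<and> p - fst c \<in> \<int>"
    then have c': "fst c \<in> {0..<1}" "snd c \<in> {0..<1}" "double_params K (fst c) (snd c)"
      unfolding classical_crossings_def by auto
    then have "q - snd c \<in> \<int>" using double_params_unique q c by blast
    then have "frac q = snd c" "frac p = fst c"
      using c c' eq_if_diff_Ints frac_mem Ints_diff_trans diff_frac_Ints by blast+
    then show "c = (frac p, frac q)" by simp
  qed
qed (auto simp: classical_crossings_def)

lemma gauss_repD:
  assumes "gauss_rep K X"
  shows "finite X"
    and "c \<in> X \<Longrightarrow> fst c \<in> overs K" "c \<in> X \<Longrightarrow> double_params K (fst c) (snd c)"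
    and "p \<in> overs K \<Longrightarrow> \<exists>c\<in>X. p - fst c \<in> \<int>"
    and "c \<in> X \<Longrightarrow> c' \<in> X \<Longrightarrow> fst c - fst c' \<in> \<int> \<Longrightarrow> c = c'"
proof -
  show "c = c'" if "c \<in> X" "c' \<in> X" "fst c - fst c' \<in> \<int>"
  proof -
    have "fst c \<in> overs K" using assms that unfolding gauss_rep_def by blast
    then have "\<exists>!d. d \<in> X \<and> fst c - fst d \<in> \<int>" using assms unfolding gauss_rep_def by blast
    moreover have "fst c - fst c \<in> \<int>" by simp
    ultimately show ?thesis using that by blast
  qed
qed (use assms in \<open>unfold gauss_rep_def, blast+\<close>)

lemma gauss_poly_rep_eq:
  assumes X: "gauss_rep K X" and X': "gauss_rep K X'"
  shows "gauss_poly (csign K) X' = gauss_poly (csign K) X"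
proof -
  have "\<forall>c\<in>X. \<exists>d\<in>X'. fst c - fst d \<in> \<int>"
    using gauss_repD[OF X] gauss_repD[OF X'] by blast
  \<comment> \<open>Each crossing goes to the one with the same over-parameter on the circle. The
    under-parameters then agree as well, because there are no triple points.\<close>
  then obtain f where f: "\<And>c. c \<in> X \<Longrightarrow> f c \<in> X' \<and> fst c - fst (f c) \<in> \<int>" by metis
  have snd: "snd c - snd (f c) \<in> \<int>" if "c \<in> X" for c
    using double_params_unique gauss_repD(3)[OF X] gauss_repD(3)[OF X'] f that by blast
  have bij: "bij_betw f X X'"
  proof (rule bij_betw_imageI)
    show "inj_on f X"
    proof (rule inj_onI)
      fix c d assume cd: "c \<in> X" "d \<in> X" "f c = f d"
      then have "fst c - fst d \<in> \<int>"
        using f[of c] f[of d] Ints_diff_trans diff_in_Ints_commute by metis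
      then show "c = d" using gauss_repD(5)[OF X] cd by blast
    qed
    show "f ` X = X'"
    proof (intro equalityI subsetI)
      fix d assume d: "d \<in> X'"
      then obtain c where c: "c \<in> X" "fst d - fst c \<in> \<int>"
        using gauss_repD(2)[OF X'] gauss_repD(4)[OF X] by blast
      then have "fst d - fst (f c) \<in> \<int>" using f Ints_diff_trans by blast
      then have "d = f c" using gauss_repD(5)[OF X'] d f c by blast
      then show "d \<in> f ` X" using c by blast
    qed (use f in auto)
  qed
  have e: "csign K (f c) = csign K c" if "c \<in> X" for c
    using csign_cong_Ints[of "fst c" "fst (f c)" "snd c" "snd (f c)"] f snd that by simp
  \<comment> \<open>Moving a representative down by an integer raises its ceiling by that integer.
    The differences are integers, so the floors are exact, and \<open>k\<close> is the signed
    total.\<close>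
  define k where "k = (\<Sum>c\<in>X. csign K c * (\<lfloor>fst c - fst (f c)\<rfloor> - \<lfloor>snd c - snd (f c)\<rfloor>))"
  have ceil: "\<lceil>x - b\<rceil> = \<lceil>x - a\<rceil> + \<lfloor>a - b\<rfloor>" if ab: "a - b \<in> \<int>" for x a b :: real
  proof -
    obtain n :: int where n: "a - b = of_int n" using ab by (rule Ints_cases)
    then have "x - b = (x - a) + of_int n" by simp
    then have "\<lceil>x - b\<rceil> = \<lceil>x - a\<rceil> + n" using ceiling_add_of_int[of "x - a" n] by metis
    then show ?thesis unfolding n by simp
  qed
  have l: "level (csign K) X' x = level (csign K) X x + k" for x
  proof -
    have "level (csign K) X' x =
      (\<Sum>c\<in>X. csign K (f c) * (\<lceil>x - fst (f c)\<rceil> - \<lceil>x - snd (f c)\<rceil>))"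
      unfolding level_def by (rule sum.reindex_bij_betw[OF bij, symmetric])
    also have "\<dots> = level (csign K) X x + k"
      unfolding level_def k_def sum.distrib[symmetric]
    proof (rule sum.cong[OF refl])
      fix c assume c: "c \<in> X"
      have "\<lceil>x - fst (f c)\<rceil> = \<lceil>x - fst c\<rceil> + \<lfloor>fst c - fst (f c)\<rfloor>"
           "\<lceil>x - snd (f c)\<rceil> = \<lceil>x - snd c\<rceil> + \<lfloor>snd c - snd (f c)\<rfloor>"
        using ceil f[OF c] snd[OF c] by blast+
      then show "csign K (f c) * (\<lceil>x - fst (f c)\<rceil> - \<lceil>x - snd (f c)\<rceil>) =
         csign K c * (\<lceil>x - fst c\<rceil> - \<lceil>x - snd c\<rceil>) +
         csign K c * (\<lfloor>fst c - fst (f c)\<rfloor> - \<lfloor>snd c - snd (f c)\<rfloor>)"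
        by (simp only: e[OF c]) (simp add: algebra_simps)
    qed
    finally show ?thesis .
  qed
  have lf: "level (csign K) X' (fst (f c)) = level (csign K) X (fst c) + k"
       "level (csign K) X' (snd (f c)) = level (csign K) X (snd c) + k" if "c \<in> X" for c
    using level_cong_Ints[of "fst c" "fst (f c)" "csign K" X'] f[OF that] l[of "fst c"]
      level_cong_Ints[of "snd c" "snd (f c)" "csign K" X'] snd[OF that] l[of "snd c"] by simp_all
  show ?thesis
    by (rule gauss_poly_bij[where f = f and k = k]) (simp_all add: bij e lf)
qed

lemma classical_params_iff:
  assumes X: "gauss_rep K X"
  shows "s \<in> classical_params K \<longleftrightarrow> (\<exists>c\<in>X. s - fst c \<in> \<int> \<or> s - snd c \<in> \<int>)"
proof
  assume "s \<in> classical_params K"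
  then obtain q where q: "double_params K s q" "s \<in> overs K \<or> q \<in> overs K"
    unfolding classical_params_def by blast
  show "\<exists>c\<in>X. s - fst c \<in> \<int> \<or> s - snd c \<in> \<int>"
  proof (cases "s \<in> overs K")
    case True
    then show ?thesis using gauss_repD(4)[OF X] by blast
  next
    case False
    then obtain c where c: "c \<in> X" "q - fst c \<in> \<int>" using gauss_repD(4)[OF X] q by blast
    then have "s - snd c \<in> \<int>"
      using double_params_unique[of q s "fst c" "snd c"] gauss_repD(3)[OF X] q double_params_sym by blast
    then show ?thesis using c by blast
  qed
next
  assume "\<exists>c\<in>X. s - fst c \<in> \<int> \<or> s - snd c \<in> \<int>"
  then obtain c where c: "c \<in> X" "s - fst c \<in> \<int> \<or> s - snd c \<in> \<int>" by blast
  note d = gauss_repD(2,3)[OF X c(1)]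
  have z: "x - x \<in> \<int>" for x :: real by simp
  show "s \<in> classical_params K"
  proof (cases "s - fst c \<in> \<int>")
    case True
    then have "s \<in> overs K" "double_params K s (snd c)"
      using d overs_cong_Ints double_params_cong_Ints z by blast+
    then show ?thesis unfolding classical_params_def by blast
  next
    case False
    then have "double_params K s (fst c)"
      using d c double_params_sym double_params_cong_Ints z by blast
    then show ?thesis unfolding classical_params_def using d by blast
  qed
qed

lemma classical_params_eq_crossing:
  assumes "s \<in> classical_params K" "s \<in> {0..<1}"
  obtains c where "c \<in> classical_crossings K" "s = fst c \<or> s = snd c"
proof -
  obtain c where c: "c \<in> classical_crossings K" "s - fst c \<in> \<int> \<or> s - snd c \<in> \<int>"
    using assms classical_params_iff[OF gauss_rep_classical_crossings] by blast
  moreover have "fst c \<in> {0..<1}" "snd c \<in> {0..<1}"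
    using c unfolding classical_crossings_def by auto
  ultimately show ?thesis using that eq_if_diff_Ints assms by blast
qed

end

section \<open>Cheng colorings\<close>

text \<open>Left-continuity of the ceiling: the level at a crossing parameter is the level on the
  arc that arrives there.\<close>

lemma eventually_left_ceiling: "\<forall>\<^sub>F u in at_left s. \<lceil>u - a\<rceil> = \<lceil>s - a\<rceil> \<and> u - a \<notin> \<int>" for s a :: real
  unfolding eventually_at_left_field
proof (intro exI conjI allI impI)
  \<comment> \<open>The last point congruent to \<open>a\<close> strictly before
    \<open>s\<close>.\<close>
  show "a + \<lceil>s - a\<rceil> - 1 < s" by linarith
  fix u assume u: "a + \<lceil>s - a\<rceil> - 1 < u" "u < s"
  show c: "\<lceil>u - a\<rceil> = \<lceil>s - a\<rceil>" using u by linarith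
  show "u - a \<notin> \<int>"
  proof
    assume "u - a \<in> \<int>"
    then obtain n :: int where "u - a = of_int n" by (rule Ints_cases)
    then have "\<lceil>s - a\<rceil> - 1 < n" "of_int n < s - a" using u by linarith+
    then show False by linarith
  qed
qed

lemma eventually_right_ceiling:
  "\<forall>\<^sub>F u in at_right s. \<lceil>u - a\<rceil> = \<lceil>s - a\<rceil> + of_bool (s - a \<in> \<int>) \<and> u - a \<notin> \<int>" for s a :: real
  unfolding eventually_at_right_field
proof (intro exI conjI allI impI)
  \<comment> \<open>The first point congruent to \<open>a\<close> strictly after \<open>s\<close>.
    The ceiling has moved up by 1 exactly if \<open>s\<close> itself is congruent to
    \<open>a\<close>.\<close>
  show "a + \<lfloor>s - a\<rfloor> + 1 > s" by linarith
  fix u assume u: "s < u" "u < a + \<lfloor>s - a\<rfloor> + 1"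
  have "\<lceil>u - a\<rceil> = \<lfloor>s - a\<rfloor> + 1" using u by linarith
  moreover have "\<lfloor>s - a\<rfloor> = \<lceil>s - a\<rceil>" if "s - a \<in> \<int>"
    using that by (metis Ints_cases ceiling_of_int floor_of_int)
  moreover have "\<lfloor>s - a\<rfloor> + 1 = \<lceil>s - a\<rceil>" if "s - a \<notin> \<int>"
  proof -
    have "s - a \<noteq> of_int \<lfloor>s - a\<rfloor>" using that by (metis Ints_of_int)
    then show ?thesis by linarith
  qed
  ultimately show "\<lceil>u - a\<rceil> = \<lceil>s - a\<rceil> + of_bool (s - a \<in> \<int>)" by auto
  show "u - a \<notin> \<int>"
  proof
    assume "u - a \<in> \<int>"
    then obtain n :: int where n: "u - a = of_int n" by (rule Ints_cases)
    then have "n < \<lfloor>s - a\<rfloor> + 1" "s - a < of_int n" using u by linarith+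
    then show False by linarith
  qed
qed

context
  fixes K assumes K: "virtual_knot_diagram K"
begin

abbreviation (input) "cr \<equiv> classical_crossings K"
abbreviation (input) "lev \<equiv> level (csign K) (classical_crossings K)"

definition jump :: "real \<Rightarrow> int" where
  "jump s = (\<Sum>c\<in>cr. csign K c * (of_bool (s - fst c \<in> \<int>) - of_bool (s - snd c \<in> \<int>)))"

lemmas crossings_rep = gauss_rep_classical_crossings[OF K]
lemmas crossings_repD = gauss_repD[OF K crossings_rep]

lemma classical_param_iff:
  "s \<in> classical_params K \<longleftrightarrow> (\<exists>c\<in>cr. s - fst c \<in> \<int> \<or> s - snd c \<in> \<int>)"
  by (rule classical_params_iff[OF K crossings_rep])

lemma eventually_left_level:
  "\<forall>\<^sub>F u in at_left s. lev u = lev s \<and> u \<notin> classical_params K"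
proof -
  have "\<forall>\<^sub>F u in at_left s. \<forall>c\<in>cr. (\<lceil>u - fst c\<rceil> = \<lceil>s - fst c\<rceil> \<and> u - fst c \<notin> \<int>) \<and>
          (\<lceil>u - snd c\<rceil> = \<lceil>s - snd c\<rceil> \<and> u - snd c \<notin> \<int>)"
    using crossings_repD(1) by (intro eventually_ball_finite ballI eventually_conj eventually_left_ceiling)
  then show ?thesis
    by eventually_elim (auto simp: level_def classical_param_iff)
qed

lemma eventually_right_level:
  "\<forall>\<^sub>F u in at_right s. lev u = lev s + jump s \<and> u \<notin> classical_params K"
proof -
  have "\<forall>\<^sub>F u in at_right s. \<forall>c\<in>cr.
          (\<lceil>u - fst c\<rceil> = \<lceil>s - fst c\<rceil> + of_bool (s - fst c \<in> \<int>) \<and> u - fst c \<notin> \<int>) \<and>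
          (\<lceil>u - snd c\<rceil> = \<lceil>s - snd c\<rceil> + of_bool (s - snd c \<in> \<int>) \<and> u - snd c \<notin> \<int>)"
    using crossings_repD(1) by (intro eventually_ball_finite ballI eventually_conj eventually_right_ceiling)
  then show ?thesis
    by eventually_elim
      (auto simp: level_def jump_def classical_param_iff algebra_simps simp flip: sum.distrib
            intro!: sum.cong)
qed

text \<open>Over-ends of different crossings are incongruent by the choice of representatives, and
  an over-end is never congruent to an under-end because no double point is over on both strands. So
  only the summand of \<open>c\<close> remains.\<close>

lemma jump_fst:
  assumes c: "c \<in> cr"
  shows "jump (fst c) = csign K c"
proof -
  have "jump (fst c) = (\<Sum>d\<in>cr. if d = c then csign K c else 0)"
    unfolding jump_def
  proof (rule sum.cong[OF refl])
    fix d assume d: "d \<in> cr"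
    have "fst c - fst d \<in> \<int> \<longleftrightarrow> d = c" using crossings_repD(5)[OF c d] by auto
    moreover have "fst c - snd d \<notin> \<int>"
      using overs_not_both[OF K crossings_repD(2,3)[OF d]] crossings_repD(2)[OF c] overs_cong_Ints[OF K] by blast
    ultimately show "csign K d * (of_bool (fst c - fst d \<in> \<int>) - of_bool (fst c - snd d \<in> \<int>)) =
        (if d = c then csign K c else 0)" by simp
  qed
  then show ?thesis using crossings_repD(1) c by simp
qed

lemma jump_snd:
  assumes c: "c \<in> cr"
  shows "jump (snd c) = - csign K c"
proof -
  have "jump (snd c) = (\<Sum>d\<in>cr. if d = c then - csign K c else 0)"
    unfolding jump_def
  proof (rule sum.cong[OF refl])
    fix d assume d: "d \<in> cr"
    have "snd c - snd d \<in> \<int> \<longleftrightarrow> d = c"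
    proof
      assume "snd c - snd d \<in> \<int>"
      then have "fst c - fst d \<in> \<int>"
        using double_params_unique[OF K, of "snd c" "fst c" "snd d" "fst d"] crossings_repD(3)[OF c] crossings_repD(3)[OF d]
          double_params_sym[OF K] by blast
      then show "d = c" using crossings_repD(5)[OF c d] by simp
    qed simp
    moreover have "snd c - fst d \<notin> \<int>"
      using overs_not_both[OF K crossings_repD(2,3)[OF c]] crossings_repD(2)[OF d] overs_cong_Ints[OF K] by blast
    ultimately show "csign K d * (of_bool (snd c - fst d \<in> \<int>) - of_bool (snd c - snd d \<in> \<int>)) =
        (if d = c then - csign K c else 0)" by simp
  qed
  then show ?thesis using crossings_repD(1) c by simp
qed

lemma jump_eq_0: "s \<notin> classical_params K \<Longrightarrow> jump s = 0"
  unfolding jump_def classical_param_iff by (intro sum.neutral) auto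

lemma arc_through_eq:
  assumes "closed_segment u v \<subseteq> - classical_params K"
  shows "arc_through K u = arc_through K v"
proof -
  have "connected_component (- classical_params K) u v"
    by (rule connected_componentI[OF _ assms]) auto
  then have "connected_component (- classical_params K) u w \<longleftrightarrow>
             connected_component (- classical_params K) v w" for w
    by (meson connected_component_sym connected_component_trans)
  then show ?thesis unfolding arc_through_def by simp
qed

text \<open>Makes the level a function of the arc. A connected set of reals contains the segment
  between any two of its points, so no crossing lies in between; the remaining integer shift is
  absorbed by periodicity.\<close>

lemma level_arc:
  assumes "w \<in> arc_through K u"
  shows "lev w = lev u"
proof -
  obtain n T where n: "n \<in> \<int>" "connected T" "T \<subseteq> - classical_params K" "u \<in> T" "w + n \<in> T"
    using assms unfolding arc_through_def connected_component_def by blast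
  then have seg: "closed_segment u (w + n) \<subseteq> - classical_params K"
    using connected_contains_Icc[of T] by (auto simp: closed_segment_eq_real_ivl split: if_splits)
  have "lev u = lev (w + n)"
    by (rule level_cong_avoids[of "closed_segment u (w + n)"])
      (use seg in \<open>auto simp: avoids_def classical_param_iff subset_iff\<close>)
  also have "\<dots> = lev w" by (rule level_cong_Ints) (use n in simp)
  finally show ?thesis by simp
qed

text \<open>Also shows that the description in \<open>in_arc\<close> denotes something. The arc is
  sampled at a midpoint to the left of \<open>s\<close>; two values that are both eventually
  attained agree, since left neighbourhoods are not empty.\<close>

lemma eventually_in_arc:
  "\<forall>\<^sub>F u in at_left s. arc_through K u = in_arc K s \<and> lev u = lev s \<and> u \<notin> classical_params K"
proof -
  obtain b where b: "b < s" "\<And>u. b < u \<Longrightarrow> u < s \<Longrightarrow> u \<notin> classical_params K"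
    using eventually_left_level[of s] unfolding eventually_at_left_field by blast
  have A: "\<forall>\<^sub>F u in at_left s. arc_through K u = arc_through K ((b + s) / 2)"
    unfolding eventually_at_left_field using b
    by (intro exI[of _ b])
       (auto intro!: arc_through_eq b(2) simp: closed_segment_eq_real_ivl split: if_splits)
  have "in_arc K s = arc_through K ((b + s) / 2)"
    unfolding in_arc_def
  proof (rule the_equality)
    show "\<forall>\<^sub>F u in at_left s. arc_through K u = arc_through K ((b + s) / 2)" by (rule A)
    fix B assume "\<forall>\<^sub>F u in at_left s. arc_through K u = B"
    with A have "\<forall>\<^sub>F u in at_left s. B = arc_through K ((b + s) / 2)"
      by eventually_elim simp
    then show "B = arc_through K ((b + s) / 2)" by (simp add: eventually_const)
  qed
  then show ?thesis using A eventually_left_level[of s] by (simp add: eventually_conj_iff)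
qed

lemma eventually_out_arc:
  "\<forall>\<^sub>F u in at_right s. arc_through K u = out_arc K s \<and> lev u = lev s + jump s \<and>
     u \<notin> classical_params K"
proof -
  obtain b where b: "s < b" "\<And>u. s < u \<Longrightarrow> u < b \<Longrightarrow> u \<notin> classical_params K"
    using eventually_right_level[of s] unfolding eventually_at_right_field by blast
  have A: "\<forall>\<^sub>F u in at_right s. arc_through K u = arc_through K ((b + s) / 2)"
    unfolding eventually_at_right_field using b
    by (intro exI[of _ b])
       (auto intro!: arc_through_eq b(2) simp: closed_segment_eq_real_ivl split: if_splits)
  have "out_arc K s = arc_through K ((b + s) / 2)"
    unfolding out_arc_def
  proof (rule the_equality)
    show "\<forall>\<^sub>F u in at_right s. arc_through K u = arc_through K ((b + s) / 2)" by (rule A)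
    fix B assume "\<forall>\<^sub>F u in at_right s. arc_through K u = B"
    with A have "\<forall>\<^sub>F u in at_right s. B = arc_through K ((b + s) / 2)"
      by eventually_elim simp
    then show "B = arc_through K ((b + s) / 2)" by (simp add: eventually_const)
  qed
  then show ?thesis using A eventually_right_level[of s] by (simp add: eventually_conj_iff)
qed

lemma in_arc_out_arc_regular:
  assumes "s \<notin> classical_params K"
  shows "in_arc K s = arc_through K s" "out_arc K s = arc_through K s"
proof -
  obtain b where b: "b < s" "\<And>u. b < u \<Longrightarrow> u < s \<Longrightarrow> u \<notin> classical_params K \<and> arc_through K u = in_arc K s"
    using eventually_in_arc[of s] unfolding eventually_at_left_field by blast
  have "arc_through K ((b + s) / 2) = arc_through K s"
  proof (rule arc_through_eq, rule subsetI)
    fix x assume "x \<in> closed_segment ((b + s) / 2) s"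
    then have "x = s \<or> b < x \<and> x < s" using b(1) by (auto simp: closed_segment_eq_real_ivl)
    then show "x \<in> - classical_params K" using b assms by blast
  qed
  then show "in_arc K s = arc_through K s" using b(2)[of "(b + s) / 2"] b(1) by simp
  obtain d where d: "s < d" "\<And>u. s < u \<Longrightarrow> u < d \<Longrightarrow> u \<notin> classical_params K \<and> arc_through K u = out_arc K s"
    using eventually_out_arc[of s] unfolding eventually_at_right_field by blast
  have "arc_through K ((d + s) / 2) = arc_through K s"
  proof (rule arc_through_eq, rule subsetI)
    fix x assume "x \<in> closed_segment ((d + s) / 2) s"
    then have "x = s \<or> s < x \<and> x < d" using d(1) by (auto simp: closed_segment_eq_real_ivl)
    then show "x \<in> - classical_params K" using d assms by blast
  qed
  then show "out_arc K s = arc_through K s" using d(2)[of "(d + s) / 2"] d(1) by simp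
qed

lemma strands_csign:
  "csign K c = 1 \<Longrightarrow> left_strand K c = fst c" "csign K c = 1 \<Longrightarrow> right_strand K c = snd c"
  "csign K c \<noteq> 1 \<Longrightarrow> left_strand K c = snd c" "csign K c \<noteq> 1 \<Longrightarrow> right_strand K c = fst c"
  by (cases c; simp add: csign_def split: if_splits)+

lemma csign_cases: "csign K c = 1 \<or> csign K c = - 1"
  by (simp add: csign_def)

text \<open>The sign tells which of the two strands is the left one, so left and right can be traded
  for over and under: the label falls by the sign along the over-strand and rises by it along the
  under-strand.\<close>

lemma cheng_coloring_iff:
  "cheng_coloring K f \<longleftrightarrow>
     (\<forall>c\<in>cr. f (out_arc K (fst c)) = f (in_arc K (fst c)) - csign K c \<and>
             f (out_arc K (snd c)) = f (in_arc K (snd c)) + csign K c)"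
  unfolding cheng_coloring_def
proof (rule ball_cong[OF refl])
  fix c
  show "(f (out_arc K (left_strand K c)) = f (in_arc K (left_strand K c)) - 1 \<and>
         f (out_arc K (right_strand K c)) = f (in_arc K (right_strand K c)) + 1) \<longleftrightarrow>
        (f (out_arc K (fst c)) = f (in_arc K (fst c)) - csign K c \<and>
         f (out_arc K (snd c)) = f (in_arc K (snd c)) + csign K c)"
    using csign_cases[of c] strands_csign[of c] by (elim disjE) auto
qed

text \<open>Gives meaning to the choice of a coloring in \<open>weight\<close>.\<close>

lemma cheng_coloring_exists: "\<exists>f. cheng_coloring K f"
proof
  \<comment> \<open>A coloring takes sets of parameters as arguments, so the level is read off at
    some point of the arc; by \<open>level_arc\<close> every point gives the same value.\<close>
  define f where "f = (\<lambda>A. - lev (SOME x. x \<in> A))"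
  have f: "f (arc_through K u) = - lev u" if "u \<notin> classical_params K" for u
  proof -
    have "u + 0 \<in> - classical_params K" using that by simp
    then have "u \<in> arc_through K u"
      unfolding arc_through_def by (auto intro!: bexI[of _ 0])
    then have "(SOME x. x \<in> arc_through K u) \<in> arc_through K u" by (rule someI)
    then show ?thesis unfolding f_def using level_arc by simp
  qed
  have i: "f (in_arc K s) = - lev s" for s
  proof -
    have "\<forall>\<^sub>F u in at_left s. f (in_arc K s) = - lev s"
      using eventually_in_arc[of s] by eventually_elim (metis f)
    then show ?thesis by (simp add: eventually_const)
  qed
  have o: "f (out_arc K s) = - lev s - jump s" for s
  proof -
    have "\<forall>\<^sub>F u in at_right s. f (out_arc K s) = - lev s - jump s"
      using eventually_out_arc[of s] by eventually_elim (metis f minus_add_distrib uminus_add_conv_diff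
        add.commute diff_conv_add_uminus)
    then show ?thesis by (simp add: eventually_const)
  qed
  show "cheng_coloring K f"
    unfolding cheng_coloring_iff by (simp add: i o jump_fst jump_snd)
qed

text \<open>Since \<open>weight\<close> picks an arbitrary coloring, all of them must be controlled.
  Label and level jump by opposite amounts at crossings and do not change elsewhere, so their sum is
  locally constant on the connected set \<open>{0..<1}\<close>, where all crossing parameters are
  taken.\<close>

lemma cheng_coloring_unique:
  assumes f: "cheng_coloring K f"
  obtains k where "\<And>s. s \<in> {0..<1} \<Longrightarrow> f (in_arc K s) = k - lev s"
proof -
  define g where "g = (\<lambda>s. f (in_arc K s) + lev s)"
  have out: "f (out_arc K s) = f (in_arc K s) - jump s" if s: "s \<in> {0..<1}" for s
  proof (cases "s \<in> classical_params K")
    case True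
    then obtain c where "c \<in> cr" "s = fst c \<or> s = snd c"
      using classical_params_eq_crossing[OF K] s by blast
    then show ?thesis using f by (auto simp: cheng_coloring_iff jump_fst jump_snd)
  next
    case False
    then show ?thesis by (simp add: in_arc_out_arc_regular jump_eq_0)
  qed
  have loc: "\<forall>\<^sub>F u in at s within {0..<1}. g s = g u" if s: "s \<in> {0..<1}" for s
  proof -
    have "\<forall>\<^sub>F u in at_left s. g s = g u"
      using eventually_in_arc[of s]
      by eventually_elim (simp add: g_def in_arc_out_arc_regular)
    moreover have "\<forall>\<^sub>F u in at_right s. g s = g u"
      using eventually_out_arc[of s]
      by eventually_elim (use out[OF s] in \<open>simp add: g_def in_arc_out_arc_regular\<close>)
    ultimately have "\<forall>\<^sub>F u in at s. g s = g u"
      by (simp add: eventually_at_split)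
    then show ?thesis
      using eventually_at_filter filter_leD[OF at_le[of "{0..<1}" UNIV s]] by blast
  qed
  have g0: "g s = g 0" if "s \<in> {0..<1}" for s
    by (rule connected_local_const[of "{0..<1}"]) (use that loc in auto)
  show ?thesis
  proof (rule that)
    fix s :: real assume "s \<in> {0..<1}"
    from g0[OF this] show "f (in_arc K s) = g 0 - lev s" unfolding g_def by linarith
  qed
qed

lemma weight_eq:
  assumes c: "c \<in> cr"
  shows "weight K c = gauss_weight (csign K) cr c"
proof -
  define f where "f = (SOME f. cheng_coloring K f)"
  have "cheng_coloring K f" unfolding f_def using cheng_coloring_exists by (rule someI_ex)
  then obtain k where k: "\<And>s. s \<in> {0..<1} \<Longrightarrow> f (in_arc K s) = k - lev s"
    using cheng_coloring_unique by blast
  have m: "fst c \<in> {0..<1}" "snd c \<in> {0..<1}" "fst c \<noteq> snd c"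
    using c unfolding classical_crossings_def double_params_def by auto
  have s: "crossing_sign K c = csign K c"
    unfolding crossing_sign_def using strands_csign[of c] csign_cases[of c] m(3) by auto
  have w: "weight K c = (if csign K c = 1 then W_plus K f c else W_minus K f c)"
    unfolding weight_def f_def[symmetric] by (simp add: Let_def s)
  note k' = k[OF m(1)] k[OF m(2)]
  show ?thesis
    using csign_cases[of c]
  proof
    assume "csign K c = 1"
    then show ?thesis
      by (simp add: w W_plus_def gauss_weight_def strands_csign k')
  next
    assume "csign K c = - 1"
    then show ?thesis
      by (simp add: w W_minus_def gauss_weight_def strands_csign k')
  qed
qed

lemma affine_index_polynomial_eq_gauss_poly_crossings:
  "affine_index_polynomial K = gauss_poly (csign K) cr"
  unfolding affine_index_polynomial_def gauss_poly_def
proof (rule sum.cong[OF refl])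
  fix c assume c: "c \<in> cr"
  then have "fst c \<noteq> snd c" unfolding classical_crossings_def double_params_def by auto
  then have "crossing_sign K c = csign K c"
    unfolding crossing_sign_def using strands_csign[of c] csign_cases[of c] by auto
  then show "of_int (crossing_sign K c) * (t_power (weight K c) - 1) =
      of_int (csign K c) * (t_power (gauss_weight (csign K) cr c) - 1)"
    using weight_eq[OF c] by simp
qed

end

lemma affine_index_polynomial_eq:
  assumes "virtual_knot_diagram K" "gauss_rep K X"
  shows "affine_index_polynomial K = gauss_poly (csign K) X"
  using affine_index_polynomial_eq_gauss_poly_crossings[OF assms(1)]
    gauss_poly_rep_eq[OF assms gauss_rep_classical_crossings[OF assms(1)]] by simp


section \<open>Planar isotopy, change of parametrisation and detours\<close>

text \<open>Only partners and signs at over-parameters enter, so virtual crossings are free to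
  change, as the detour move requires. The crossings of \<open>K\<close> then serve as
  representatives for \<open>K'\<close>.\<close>

lemma affine_index_polynomial_cong:
  assumes K: "virtual_knot_diagram K" and K': "virtual_knot_diagram K'"
    and o: "overs K' = overs K"
    and d: "\<And>p q. p \<in> overs K \<Longrightarrow> double_params K' p q \<longleftrightarrow> double_params K p q"
    and s: "\<And>p q. p \<in> overs K \<Longrightarrow> double_params K p q \<Longrightarrow> csign K' (p, q) = csign K (p, q)"
  shows "affine_index_polynomial K' = affine_index_polynomial K"
proof -
  let ?X = "classical_crossings K"
  have "gauss_rep K' ?X"
    using gauss_rep_classical_crossings[OF K] by (simp add: gauss_rep_def o d)
  then have "affine_index_polynomial K' = gauss_poly (csign K') ?X"
    by (rule affine_index_polynomial_eq[OF K'])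
  also have "\<dots> = gauss_poly (csign K) ?X"
    by (rule gauss_poly_cong) (auto simp: classical_crossings_def intro: s)
  also have "\<dots> = affine_index_polynomial K"
    using affine_index_polynomial_eq_gauss_poly_crossings[OF K] by simp
  finally show ?thesis .
qed

text \<open>The factor \<open>wedge (L 1) (L \<i>)\<close> is the determinant of
  \<open>L\<close>.\<close>

lemma wedge_linear:
  assumes "linear L"
  shows "wedge (L v) (L w) = wedge (L 1) (L \<i>) * wedge v w"
proof -
  have L: "L z = Re z *\<^sub>R L 1 + Im z *\<^sub>R L \<i>" for z
  proof -
    have "z = Re z *\<^sub>R 1 + Im z *\<^sub>R \<i>" by (simp add: complex_eq_iff)
    then have "L z = L (Re z *\<^sub>R 1 + Im z *\<^sub>R \<i>)" by simp
    also have "\<dots> = Re z *\<^sub>R L 1 + Im z *\<^sub>R L \<i>"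
      using assms by (simp only: linear_add linear_scale)
    finally show ?thesis .
  qed
  show ?thesis
    unfolding L[of v] L[of w] wedge_def by (simp add: algebra_simps)
qed

lemma wedge_scaleR: "wedge (a *\<^sub>R v) (b *\<^sub>R w) = a * b * wedge v w"
  by (simp add: wedge_def algebra_simps)

lemma affine_index_polynomial_diffeo:
  assumes K: "virtual_knot_diagram K" and K': "virtual_knot_diagram K'"
    and h: "orientation_preserving_diffeo h"
    and c: "curve K' = h \<circ> curve K" and o: "overs K' = overs K"
  shows "affine_index_polynomial K' = affine_index_polynomial K"
proof (rule affine_index_polynomial_cong[OF K K' o])
  obtain h' where h': "bij h" "\<And>z. (h has_derivative h' z) (at z)" "\<And>z. wedge (h' z 1) (h' z \<i>) > 0"
    using h unfolding orientation_preserving_diffeo_def C1_diffeo_def by blast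
  have v: "velocity K' u = h' (curve K u) (velocity K u)" for u
    using vector_derivative_diff_chain_within[of "curve K" "velocity K u" u UNIV h "h' (curve K u)"]
      curve_has_velocity[OF K, of u] h'(2)[of "curve K u"]
    unfolding velocity_def[of K'] c by (intro vector_derivative_at) (simp add: has_derivative_at_withinI)
  show "double_params K' p q \<longleftrightarrow> double_params K p q" for p q
    using bij_is_inj[OF h'(1)] by (simp add: double_params_def c inj_eq)
  show "csign K' (p, q) = csign K (p, q)" if "double_params K p q" for p q
  proof -
    \<comment> \<open>The two strands pass through one point, so both velocities are moved by the
      same derivative, of positive determinant.\<close>
    have "curve K p = curve K q" using that by (simp add: double_params_def)
    then have "wedge (velocity K' p) (velocity K' q) =
        wedge (h' (curve K q) 1) (h' (curve K q) \<i>) * wedge (velocity K p) (velocity K q)"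
      unfolding v using wedge_linear[OF has_derivative_linear[OF h'(2)]] by metis
    then show ?thesis using h'(3)[of "curve K q"] by (simp add: csign_def zero_less_mult_iff)
  qed
qed

text \<open>The determinant of the derivative is 1 at time 0, varies continuously and never
  vanishes; by the intermediate value theorem it is still positive at time 1.\<close>

lemma ambient_isotopy_orientation_preserving:
  assumes "ambient_isotopy H"
  shows "orientation_preserving_diffeo (H 1)"
proof -
  obtain H' where H: "H 0 = id" "\<And>s. s \<in> {0..1} \<Longrightarrow> C1_diffeo (H s) (H' s)"
      "\<And>v. continuous_on ({0..1} \<times> UNIV) (\<lambda>(s, z). H' s z v)"
    using assms unfolding ambient_isotopy_def by blast
  have "wedge (H' 1 z 1) (H' 1 z \<i>) > 0" for z
  proof (rule ccontr)
    assume neg: "\<not> wedge (H' 1 z 1) (H' 1 z \<i>) > 0"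
    have cont: "continuous_on {0..1} (\<lambda>s. H' s z v)" for v
    proof -
      have "continuous_on {0..1} ((\<lambda>(s, z). H' s z v) \<circ> (\<lambda>s. (s, z)))"
        by (rule continuous_on_compose)
          (auto intro!: continuous_intros intro: continuous_on_subset[OF H(3)])
      then show ?thesis by (simp add: o_def)
    qed
    have "(id has_derivative H' 0 z) (at z)"
      using H(2)[of 0] unfolding H(1) C1_diffeo_def by simp
    then have "H' 0 z = id" using has_derivative_unique has_derivative_id by metis
    then have one: "wedge (H' 0 z 1) (H' 0 z \<i>) = 1" by (simp add: wedge_def)
    have "continuous_on {0..1} (\<lambda>s. wedge (H' s z 1) (H' s z \<i>))"
      unfolding wedge_def by (intro continuous_intros cont)
    then obtain s where "s \<in> {0..1}" "wedge (H' s z 1) (H' s z \<i>) = 0"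
      using IVT2'[of "\<lambda>s. wedge (H' s z 1) (H' s z \<i>)" 1 0 0] one neg by auto
    then show False using H(2)[of s] unfolding C1_diffeo_def by blast
  qed
  then show ?thesis using H(2)[of 1] unfolding orientation_preserving_diffeo_def by auto
qed

lemma affine_index_polynomial_planar_isotopic:
  assumes "virtual_knot_diagram K" "virtual_knot_diagram K'" "planar_isotopic K K'"
  shows "affine_index_polynomial K' = affine_index_polynomial K"
  using assms affine_index_polynomial_diffeo ambient_isotopy_orientation_preserving
  unfolding planar_isotopic_def by blast

text \<open>\<phi> carries the crossings of \<open>K'\<close> to \<open>K\<close>. Their images may
  leave \<open>[0,1)\<close>, but they are representatives all the same, and the ceilings in the
  level do not change.\<close>

lemma affine_index_polynomial_reparametrized:
  assumes K: "virtual_knot_diagram K" and K': "virtual_knot_diagram K'" and r: "reparametrized K K'"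
  shows "affine_index_polynomial K' = affine_index_polynomial K"
proof -
  obtain \<phi> \<phi>' where \<phi>: "\<And>u. (\<phi> has_real_derivative \<phi>' u) (at u)" "\<And>u. \<phi>' u > 0"
      "\<And>u. \<phi> (u + 1) = \<phi> u + 1" and c: "curve K' = curve K \<circ> \<phi>" and o: "overs K' = \<phi> -` overs K"
    using r unfolding reparametrized_def by blast
  have mono: "\<phi> x < \<phi> y" if "x < y" for x y
    using DERIV_pos_imp_increasing[OF that] \<phi> by blast
  have le: "\<phi> x \<le> \<phi> y \<longleftrightarrow> x \<le> y" for x y
    using mono[of x y] mono[of y x] by (metis less_eq_real_def not_le)
  have inj: "\<phi> x = \<phi> y \<longleftrightarrow> x = y" for x y
    using le[of x y] le[of y x] by auto
  have nat: "\<phi> (u + real m) = \<phi> u + real m" for u m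
  proof (induction m)
    case (Suc m)
    have "\<phi> (u + real (Suc m)) = \<phi> ((u + real m) + 1)" by (simp add: algebra_simps)
    then show ?case using Suc \<phi>(3) by simp
  qed simp
  have shift: "\<phi> (u + of_int n) = \<phi> u + of_int n" for u n
  proof (cases "n \<ge> 0")
    case True
    then show ?thesis using nat[of u "nat n"] by simp
  next
    case False
    then show ?thesis using nat[of "u + of_int n" "nat (- n)"] by simp
  qed
  have Ints: "\<phi> x - \<phi> y \<in> \<int> \<longleftrightarrow> x - y \<in> \<int>" for x y
  proof
    assume "\<phi> x - \<phi> y \<in> \<int>"
    then obtain n :: int where n: "\<phi> x - \<phi> y = of_int n" by (rule Ints_cases)
    then have "\<phi> x = \<phi> (y + of_int n)" using shift[of y n] by simp
    then show "x - y \<in> \<int>" by (simp add: inj)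
  next
    assume "x - y \<in> \<int>"
    then obtain n :: int where n: "x - y = of_int n" by (rule Ints_cases)
    then have "x = y + of_int n" by simp
    then show "\<phi> x - \<phi> y \<in> \<int>" using shift[of y n] by simp
  qed
  \<comment> \<open>Ceilings only compare differences with integers \<open>n\<close>, and
    \<open>\<phi> x \<le> \<phi> y + n\<close> means \<open>\<phi> x \<le> \<phi> (y + n)\<close>,
    hence \<open>x \<le> y + n\<close>.\<close>
  have ceil: "\<lceil>\<phi> x - \<phi> y\<rceil> = \<lceil>x - y\<rceil>" for x y
  proof -
    have "\<lceil>\<phi> x - \<phi> y\<rceil> \<le> n \<longleftrightarrow> \<lceil>x - y\<rceil> \<le> n" for n
    proof -
      have "\<phi> x \<le> \<phi> (y + of_int n) \<longleftrightarrow> x \<le> y + of_int n" by (rule le)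
      then show ?thesis by (simp add: ceiling_le_iff shift algebra_simps)
    qed
    then show ?thesis by (meson order_antisym order_refl)
  qed
  have surj: "\<exists>x. \<phi> x = y" for y
  proof -
    \<comment> \<open>The integer \<open>a\<close> is chosen such that
      \<open>\<phi> 0 + a \<le> y \<le> \<phi> 0 + a + 1\<close>; these bounds are the values of
      \<phi> at \<open>a\<close> and \<open>b\<close>.\<close>
    define a b where "a = of_int (\<lfloor>y - \<phi> 0\<rfloor>)" and "b = a + (1::real)"
    have "\<phi> a \<le> y" "y \<le> \<phi> b"
      using shift[of 0 "\<lfloor>y - \<phi> 0\<rfloor>"] \<phi>(3)[of a] unfolding a_def b_def by (simp_all, linarith+)
    moreover have "a \<le> b" unfolding b_def by simp
    moreover have "continuous_on {a..b} \<phi>"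
      using \<phi>(1) by (meson DERIV_continuous_on has_field_derivative_at_within)
    ultimately show ?thesis using IVT'[of \<phi> a y b] by blast
  qed
  have dbl: "double_params K (\<phi> p) (\<phi> q) \<longleftrightarrow> double_params K' p q" for p q
    by (simp add: double_params_def Ints c)
  have v: "velocity K' u = \<phi>' u *\<^sub>R velocity K (\<phi> u)" for u
    unfolding velocity_def[of K'] c
    using \<phi>(1) curve_has_velocity[OF K]
    by (intro vector_derivative_at vector_diff_chain_at)
      (auto simp: has_real_derivative_iff_has_vector_derivative)
  have cs: "csign K (\<phi> p, \<phi> q) = csign K' (p, q)" for p q
  proof -
    have "0 < \<phi>' p * \<phi>' q" using \<phi>(2) by simp
    then have "0 < \<phi>' p * \<phi>' q * x \<longleftrightarrow> 0 < x" for x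
      by (metis mult_pos_pos zero_less_mult_pos)
    then show ?thesis by (simp add: csign_def v wedge_scaleR)
  qed
  let ?X = "classical_crossings K'" and ?f = "map_prod \<phi> \<phi>"
  note rep = gauss_repD[OF K' gauss_rep_classical_crossings[OF K']]
  have "gauss_rep K (?f ` ?X)"
    unfolding gauss_rep_def
  proof (intro conjI ballI)
    show "finite (?f ` ?X)" using rep(1) by blast
    show "fst c \<in> overs K" "double_params K (fst c) (snd c)" if "c \<in> ?f ` ?X" for c
      using that rep(2,3) by (auto simp: o dbl)
    fix p assume p: "p \<in> overs K"
    obtain x where x: "p = \<phi> x" using surj by metis
    then obtain c where c: "c \<in> ?X" "x - fst c \<in> \<int>" using p rep(4)[of x] o by blast
    show "\<exists>!c. c \<in> ?f ` ?X \<and> p - fst c \<in> \<int>"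
    proof (rule ex1I[of _ "?f c"])
      show "?f c \<in> ?f ` ?X \<and> p - fst (?f c) \<in> \<int>" using c x by (simp add: Ints)
      fix d assume "d \<in> ?f ` ?X \<and> p - fst d \<in> \<int>"
      then obtain d' where d': "d' \<in> ?X" "d = ?f d'" "x - fst d' \<in> \<int>" using x by (auto simp: Ints)
      then have "fst d' - fst c \<in> \<int>" using c Ints_diff_trans diff_in_Ints_commute by metis
      then show "d = ?f c" using rep(5) d' c by blast
    qed
  qed
  then have "affine_index_polynomial K = gauss_poly (csign K) (?f ` ?X)"
    by (rule affine_index_polynomial_eq[OF K])
  also have "\<dots> = gauss_poly (csign K') ?X"
  proof (rule gauss_poly_bij[where f = ?f and k = 0])
    have inj_f: "inj_on ?f ?X" by (auto simp: inj_on_def inj)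
    then show "bij_betw ?f ?X (?f ` ?X)" by (rule inj_on_imp_bij_betw)
    show e: "csign K (?f c) = csign K' c" for c by (cases c) (simp add: cs)
    have "level (csign K) (?f ` ?X) (\<phi> x) = level (csign K') ?X x" for x
      unfolding level_def sum.reindex[OF inj_f] by (simp add: e ceil)
    then show "level (csign K) (?f ` ?X) (fst (?f c)) = level (csign K') ?X (fst c) + 0 \<and>
          level (csign K) (?f ` ?X) (snd (?f c)) = level (csign K') ?X (snd c) + 0" for c by simp
  qed
  also have "\<dots> = affine_index_polynomial K'"
    using affine_index_polynomial_eq_gauss_poly_crossings[OF K'] by simp
  finally show ?thesis by simp
qed

section \<open>Detours\<close>

lemma velocity_cong_open:
  assumes "virtual_knot_diagram K" "open S" "u \<in> S" "\<And>x. x \<in> S \<Longrightarrow> curve K' x = curve K x"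
  shows "velocity K' u = velocity K u"
  using has_vector_derivative_transform_within_open[OF curve_has_velocity[OF assms(1), of u] assms(2,3)]
    assms(4) unfolding velocity_def[of K'] by (metis vector_derivative_at)

text \<open>Keeps the complement of the altered part of a diagram open, so that the velocities
  there, being limits, are not affected either.\<close>

lemma closed_add_Ints:
  fixes T :: "real set"
  assumes "compact T"
  shows "closed {u + k | u k. u \<in> T \<and> k \<in> \<int>}"
proof -
  have "{u + k | u k. u \<in> T \<and> k \<in> \<int>} = (\<Union>u\<in>T. \<Union>k\<in>\<int>. {u + k})" by auto
  then show ?thesis using compact_closed_sums[OF assms closed_Ints] by simp
qed

lemma affine_index_polynomial_detour:
  assumes K: "virtual_knot_diagram K" and K': "virtual_knot_diagram K'" and d: "detour K K'"
  shows "affine_index_polynomial K' = affine_index_polynomial K"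
proof -
  obtain a b where d': "let E = {u + k | u k. u \<in> {a..b} \<and> k \<in> \<int>} in
           (\<forall>u. u \<notin> E \<longrightarrow> curve K' u = curve K u) \<and> overs K' = overs K \<and>
           E \<inter> classical_params K = {} \<and> E \<inter> classical_params K' = {}"
    using d unfolding detour_def by blast
  define E where "E = {u + k | u k. u \<in> {a..b} \<and> k \<in> \<int>}"
  have E: "\<And>u. u \<notin> E \<Longrightarrow> curve K' u = curve K u" "overs K' = overs K"
      "E \<inter> classical_params K = {}" "E \<inter> classical_params K' = {}"
    using d' unfolding E_def[symmetric] Let_def by blast+
  have op: "open (- E)" unfolding E_def using closed_add_Ints[of "{a..b}"] by (simp add: open_closed)
  \<comment> \<open>Both ends of a classical crossing of either diagram are classical parameters,
    and the rerouted arc contains none.\<close>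
  have notE: "p \<notin> E \<and> q \<notin> E" if "p \<in> overs K" "double_params K p q \<or> double_params K' p q" for p q
  proof -
    have "p \<in> classical_params K \<inter> {p. q \<in> classical_params K} \<or>
          p \<in> classical_params K' \<inter> {p. q \<in> classical_params K'}"
      using that E(2) double_params_sym[OF K] double_params_sym[OF K']
      unfolding classical_params_def by blast
    then show ?thesis using E(3,4) by blast
  qed
  show ?thesis
  proof (rule affine_index_polynomial_cong[OF K K' E(2)])
    fix p q assume p: "p \<in> overs K"
    show "double_params K' p q \<longleftrightarrow> double_params K p q"
      using notE[OF p, of q] E(1)[of p] E(1)[of q] unfolding double_params_def by metis
    assume "double_params K p q"
    then have "p \<in> - E" "q \<in> - E" using notE p by blast+
    then have "velocity K' p = velocity K p" "velocity K' q = velocity K q"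
      using velocity_cong_open[OF K op] E(1) by blast+
    then show "csign K' (p, q) = csign K (p, q)" by (simp add: csign_def)
  qed
qed


section \<open>Local pictures\<close>

lemma mem_strand_params_iff:
  "u \<in> strand_params n c r \<longleftrightarrow> (\<exists>i<n. \<exists>t\<in>{-1..1}. u - (c i + r i * t) \<in> \<int>)"
proof
  assume "\<exists>i<n. \<exists>t\<in>{-1..1}. u - (c i + r i * t) \<in> \<int>"
  then obtain i t where "i < n" "t \<in> {-1..1}" "u - (c i + r i * t) \<in> \<int>" by blast
  moreover have "u = c i + r i * t + (u - (c i + r i * t))" by simp
  ultimately show "u \<in> strand_params n c r" unfolding strand_params_def by blast
next
  assume "u \<in> strand_params n c r"
  then obtain i t k where u: "u = c i + r i * t + k" "i < n" "t \<in> {-1..1}" "k \<in> \<int>"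
    unfolding strand_params_def by blast
  then have "u - (c i + r i * t) \<in> \<int>" by simp
  then show "\<exists>i<n. \<exists>t\<in>{-1..1}. u - (c i + r i * t) \<in> \<int>" using u by blast
qed

lemma closed_strand_params: "closed (strand_params n c r)"
proof -
  let ?T = "\<Union>i<n. (\<lambda>t. c i + r i * t) ` {-1..1}"
  have "strand_params n c r = {u + k | u k. u \<in> ?T \<and> k \<in> \<int>}"
    unfolding strand_params_def by blast
  moreover have "compact ?T"
    by (intro compact_UN compact_continuous_image continuous_intros) auto
  ultimately show ?thesis using closed_add_Ints[of ?T] by metis
qed

text \<open>One lift of the strand to the line, without its integer translates, and hence an
  interval.\<close>

definition strand :: "(nat \<Rightarrow> real) \<Rightarrow> (nat \<Rightarrow> real) \<Rightarrow> nat \<Rightarrow> real set" where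
  "strand c r i = (\<lambda>t. c i + r i * t) ` {-1..1}"

lemma convex_strand: "convex (strand c r i)"
  unfolding strand_def using convex_affinity[of "{-1..1::real}" "c i" "r i"] by simp

lemma mem_strandI: "t \<in> {-1..1} \<Longrightarrow> c i + r i * t \<in> strand c r i"
  unfolding strand_def by (rule imageI)

text \<open>Representatives for the crossings outside the picture, shared by the two diagrams of a
  move.\<close>

definition outer_rep :: "vdiagram \<Rightarrow> real set \<Rightarrow> (real \<times> real) set \<Rightarrow> bool" where
  "outer_rep K S Y \<longleftrightarrow> finite Y \<and>
     (\<forall>c\<in>Y. fst c \<in> overs K \<and> double_params K (fst c) (snd c) \<and> fst c \<notin> S \<and> snd c \<notin> S) \<and>
     (\<forall>p\<in>overs K. p \<notin> S \<longrightarrow> (\<exists>!c. c \<in> Y \<and> p - fst c \<in> \<int>))"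

text \<open>By \<open>emb\<close> the strands are disjoint, and each is embedded, on the circle of
  parameters. \<open>looks_like\<close> does not include this; each move derives it from its own
  pictures.\<close>

locale local_picture =
  fixes K h n M c r
  assumes K: "virtual_knot_diagram K"
    and inj: "inj h"
    and look: "looks_like K h n M c r"
    and box: "\<And>i t. i < n \<Longrightarrow> t \<in> {-1..1} \<Longrightarrow> M i t \<in> cbox (Complex (- 1) (- 1)) (Complex 1 1)"
    and emb: "\<And>i j s t. i < n \<Longrightarrow> j < n \<Longrightarrow> s \<in> {-1..1} \<Longrightarrow> t \<in> {-1..1} \<Longrightarrow>
      c i + r i * s - (c j + r j * t) \<in> \<int> \<Longrightarrow> i = j \<and> s = t"
begin

lemma curve_strand: "i < n \<Longrightarrow> t \<in> {-1..1} \<Longrightarrow> curve K (c i + r i * t) = h (M i t)"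
  using look unfolding looks_like_def by blast

lemma r_nonzero: "i < n \<Longrightarrow> r i \<noteq> 0"
  using look unfolding looks_like_def by blast

lemma double_strand:
  assumes "i < n" "j < n" "s \<in> {-1..1}" "t \<in> {-1..1}" "M i s = M j t" "i \<noteq> j \<or> s \<noteq> t"
  shows "double_params K (c i + r i * s) (c j + r j * t)"
  unfolding double_params_def
  using emb[OF assms(1-4)] curve_strand[OF assms(1,3)] curve_strand[OF assms(2,4)] assms(5,6) by auto

text \<open>The strand lies in the box and only listed strands enter the box, so the partner of a
  strand parameter is again on a strand. Injectivity of \<open>h\<close> then moves the double point
  into the standard picture.\<close>

lemma strand_double:
  assumes "i < n" "s \<in> {-1..1}" "double_params K (c i + r i * s) v"
  obtains j t where "j < n" "t \<in> {-1..1}" "v - (c j + r j * t) \<in> \<int>" "M i s = M j t"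
    "i \<noteq> j \<or> s \<noteq> t"
proof -
  have "curve K v = h (M i s)"
    using assms curve_strand unfolding double_params_def by simp
  then have "curve K v \<in> h ` cbox (Complex (- 1) (- 1)) (Complex 1 1)"
    using box assms by blast
  then have "v \<in> strand_params n c r"
    using look unfolding looks_like_def by blast
  then obtain j t where jt: "j < n" "t \<in> {-1..1}" "v - (c j + r j * t) \<in> \<int>"
    unfolding mem_strand_params_iff by blast
  then have "h (M j t) = h (M i s)"
    using curve_cong_Ints[OF K jt(3)] curve_strand \<open>curve K v = h (M i s)\<close> by simp
  then have "M i s = M j t" using inj by (simp add: inj_eq)
  moreover have "i \<noteq> j \<or> s \<noteq> t"
    using assms(3) jt(3) diff_in_Ints_commute unfolding double_params_def by blast
  ultimately show ?thesis using that jt by blast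
qed

text \<open>This is why the crossings split into inner and outer ones.\<close>

lemma double_mem_strand_params_iff:
  assumes "double_params K p q"
  shows "p \<in> strand_params n c r \<longleftrightarrow> q \<in> strand_params n c r"
proof -
  have *: "q \<in> strand_params n c r" if pq: "double_params K p q" and p: "p \<in> strand_params n c r" for p q
  proof -
    obtain i s where i_s: "i < n" "s \<in> {-1..1}" "p - (c i + r i * s) \<in> \<int>"
      using p unfolding mem_strand_params_iff by blast
    have "double_params K (c i + r i * s) q"
      using double_params_cong_Ints[OF K i_s(3), of q q] pq by simp
    then obtain j t where "j < n" "t \<in> {-1..1}" "q - (c j + r j * t) \<in> \<int>"
      using strand_double[OF i_s(1,2)] by metis
    then show ?thesis unfolding mem_strand_params_iff by blast
  qed
  then show ?thesis using assms double_params_sym[OF K] by blast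
qed

lemma strand_over:
  assumes "p \<in> overs K" "p \<in> strand_params n c r"
  obtains i j s t where "i < n" "j < n" "s \<in> {-1..1}" "t \<in> {-1..1}"
    "p - (c i + r i * s) \<in> \<int>" "c i + r i * s \<in> overs K" "M i s = M j t" "i \<noteq> j \<or> s \<noteq> t"
proof -
  obtain i s where i_s: "i < n" "s \<in> {-1..1}" "p - (c i + r i * s) \<in> \<int>"
    using assms unfolding mem_strand_params_iff by blast
  have o: "c i + r i * s \<in> overs K" using overs_cong_Ints[OF K i_s(3)] assms by simp
  then obtain v where "double_params K (c i + r i * s) v" using overs_partner[OF K] by blast
  then obtain j t where "j < n" "t \<in> {-1..1}" "M i s = M j t" "i \<noteq> j \<or> s \<noteq> t"
    using strand_double[OF i_s(1,2)] by metis
  then show ?thesis using that i_s o by blast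
qed

lemma strand_disjoint:
  "i < n \<Longrightarrow> j < n \<Longrightarrow> i \<noteq> j \<Longrightarrow> x \<in> strand c r i \<Longrightarrow> y \<in> strand c r j \<Longrightarrow> x - y \<notin> \<int>"
  using emb unfolding strand_def by blast

lemma strand_diff_notin_Ints:
  "i < n \<Longrightarrow> s \<in> {-1..1} \<Longrightarrow> t \<in> {-1..1} \<Longrightarrow> s \<noteq> t \<Longrightarrow>
     (c i + r i * s) - (c i + r i * t) \<notin> \<int>"
  using emb by blast

lemma strand_short:
  assumes "i < n"
  shows "2 * \<bar>r i\<bar> < 1"
proof (rule ccontr)
  assume "\<not> 2 * \<bar>r i\<bar> < 1"
  then have r: "\<bar>r i\<bar> \<ge> 1 / 2" by simp
  then have "1 / \<bar>r i\<bar> \<le> 2" "1 / \<bar>r i\<bar> > 0" by (simp_all add: field_simps)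
  \<comment> \<open>One full period away from the start of the strand at -1, and still on the strand
    because \<open>1 / \<bar>r i\<bar> \<le> 2\<close>.\<close>
  then have t: "1 / \<bar>r i\<bar> - 1 \<in> {-1..1}" "1 / \<bar>r i\<bar> - 1 \<noteq> - 1" by auto
  have "r i * (1 / \<bar>r i\<bar>) = 1 \<or> r i * (1 / \<bar>r i\<bar>) = - 1"
    using r by (auto simp: abs_if)
  then have "(c i + r i * (1 / \<bar>r i\<bar> - 1)) - (c i + r i * (- 1)) \<in> \<int>"
    by (auto simp: right_diff_distrib)
  then show False using strand_diff_notin_Ints[OF assms t(1) _ t(2)] by simp
qed

text \<open>A strand is shorter than one period, so the ceiling only records which of the two points
  comes first on the line.\<close>

lemma ceiling_strand_diff:
  assumes "i < n" "s \<in> {-1..1}" "t \<in> {-1..1}" "s \<noteq> t"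
  shows "\<lceil>(c i + r i * s) - (c i + r i * t)\<rceil> = of_bool (0 < r i * (s - t))"
proof -
  have "\<bar>r i * (s - t)\<bar> \<le> \<bar>r i\<bar> * 2"
    unfolding abs_mult using assms by (intro mult_left_mono) auto
  then have "\<bar>r i * (s - t)\<bar> < 1" using strand_short[OF assms(1)] by simp
  moreover have "r i * (s - t) \<noteq> 0" using assms r_nonzero by simp
  moreover have "(c i + r i * s) - (c i + r i * t) = r i * (s - t)" by (simp add: algebra_simps)
  ultimately show ?thesis by (auto simp: ceiling_eq_iff)
qed

lemma avoids_outer:
  assumes "outer_rep K (strand_params n c r) Y" "i < n"
  shows "avoids Y (strand c r i)"
  unfolding avoids_def
proof (intro ballI)
  fix d a assume d: "d \<in> Y" and a: "a \<in> strand c r i"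
  then have "fst d \<notin> strand_params n c r" "snd d \<notin> strand_params n c r"
    using assms unfolding outer_rep_def by blast+
  then show "a - fst d \<notin> \<int> \<and> a - snd d \<notin> \<int>"
    using a assms(2) diff_in_Ints_commute unfolding mem_strand_params_iff strand_def by blast
qed

lemma outer_rep_exists: "\<exists>Y. outer_rep K (strand_params n c r) Y"
proof
  let ?S = "strand_params n c r"
  let ?Y = "{d \<in> classical_crossings K. fst d \<notin> ?S}"
  note rep = gauss_repD[OF K gauss_rep_classical_crossings[OF K]]
  have S: "x \<in> ?S \<longleftrightarrow> y \<in> ?S" if "x - y \<in> \<int>" for x y
    using that Ints_diff_trans diff_in_Ints_commute unfolding mem_strand_params_iff by metis
  show "outer_rep K ?S ?Y"
    unfolding outer_rep_def
  proof (intro conjI ballI impI)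
    show "finite ?Y" using rep(1) by simp
    show "snd d \<notin> ?S" if "d \<in> ?Y" for d
      using that rep(3) double_mem_strand_params_iff by blast
    fix p assume p: "p \<in> overs K" "p \<notin> ?S"
    then obtain d where d: "d \<in> classical_crossings K" "p - fst d \<in> \<int>" using rep(4) by blast
    show "\<exists>!d. d \<in> ?Y \<and> p - fst d \<in> \<int>"
    proof (rule ex1I[of _ d])
      show "d \<in> ?Y \<and> p - fst d \<in> \<int>" using d S p by blast
      fix d' assume "d' \<in> ?Y \<and> p - fst d' \<in> \<int>"
      then have "fst d' - fst d \<in> \<int>" using d Ints_diff_trans diff_in_Ints_commute by metis
      then show "d' = d" using rep(5) d \<open>d' \<in> ?Y \<and> p - fst d' \<in> \<int>\<close> by blast
    qed
  qed (use rep in auto)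
qed

text \<open>\<open>Z\<close> is meant for the crossings seen in the picture; the representatives on
  the two sides of a move then differ in \<open>Z\<close> alone.\<close>

lemma gauss_rep_Un_outer:
  assumes Y: "outer_rep K (strand_params n c r) Y"
    and Z: "finite Z" "\<And>d. d \<in> Z \<Longrightarrow> fst d \<in> overs K \<and> double_params K (fst d) (snd d)"
      "\<And>d. d \<in> Z \<Longrightarrow> fst d \<in> strand_params n c r"
      "\<And>d d'. d \<in> Z \<Longrightarrow> d' \<in> Z \<Longrightarrow> fst d - fst d' \<in> \<int> \<Longrightarrow> d = d'"
      "\<And>p. p \<in> overs K \<Longrightarrow> p \<in> strand_params n c r \<Longrightarrow> \<exists>d\<in>Z. p - fst d \<in> \<int>"
  shows "gauss_rep K (Z \<union> Y)"
  unfolding gauss_rep_def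
proof (intro conjI ballI)
  let ?S = "strand_params n c r"
  have S: "x \<in> ?S \<longleftrightarrow> y \<in> ?S" if "x - y \<in> \<int>" for x y
    using that Ints_diff_trans diff_in_Ints_commute unfolding mem_strand_params_iff by metis
  show "finite (Z \<union> Y)" using Y Z(1) unfolding outer_rep_def by simp
  show "fst d \<in> overs K" "double_params K (fst d) (snd d)" if "d \<in> Z \<union> Y" for d
    using Y Z(2) that unfolding outer_rep_def by blast+
  fix p assume p: "p \<in> overs K"
  have Yn: "p \<notin> ?S" if "d \<in> Y" "p - fst d \<in> \<int>" for d
    using Y that S unfolding outer_rep_def by blast
  have Zn: "p \<in> ?S" if "d \<in> Z" "p - fst d \<in> \<int>" for d
    using Z(3) that S by blast
  show "\<exists>!d. d \<in> Z \<union> Y \<and> p - fst d \<in> \<int>"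
  proof (cases "p \<in> ?S")
    case True
    then obtain d where d: "d \<in> Z" "p - fst d \<in> \<int>" using Z(5) p by blast
    show ?thesis
    proof (rule ex1I[of _ d])
      fix d' assume d': "d' \<in> Z \<union> Y \<and> p - fst d' \<in> \<int>"
      then have "d' \<in> Z" using Yn True by blast
      moreover have "fst d' - fst d \<in> \<int>" using d d' Ints_diff_trans diff_in_Ints_commute by metis
      ultimately show "d' = d" using Z(4) d by blast
    qed (use d in blast)
  next
    case False
    then have "\<exists>!d. d \<in> Y \<and> p - fst d \<in> \<int>" using Y p unfolding outer_rep_def by blast
    then show ?thesis using Zn False by blast
  qed
qed

text \<open>Chain rule for \<open>h\<close> after \<open>M i\<close> after the inverse of the affine
  parametrisation, whose slope is \<open>1 / r i\<close>. The picture determines the curve along the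
  strand only, so a two-sided derivative needs an interior parameter.\<close>

lemma velocity_strand:
  assumes h: "\<And>z. (h has_derivative h' z) (at z)"
    and i: "i < n" "t \<in> {-1<..<1}" and M: "(M i has_vector_derivative d) (at t)"
  shows "velocity K (c i + r i * t) = (1 / r i) *\<^sub>R h' (M i t) d"
proof -
  note r = r_nonzero[OF i(1)]
  let ?u = "c i + r i * t"
  have 1: "((\<lambda>u. (u - c i) / r i) has_vector_derivative 1 / r i) (at ?u)"
    using r by (auto intro!: derivative_eq_intros simp flip: has_real_derivative_iff_has_vector_derivative)
  have t: "(?u - c i) / r i = t" using r by simp
  have 2: "(M i \<circ> (\<lambda>u. (u - c i) / r i) has_vector_derivative (1 / r i) *\<^sub>R d) (at ?u)"
    by (rule vector_diff_chain_at[OF 1]) (simp only: t M)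
  have 3: "(h \<circ> (M i \<circ> (\<lambda>u. (u - c i) / r i)) has_vector_derivative h' (M i t) ((1 / r i) *\<^sub>R d)) (at ?u)"
    using vector_derivative_diff_chain_within[OF 2, of h "h' (M i t)"] h[of "M i t"] t
    by (simp add: has_derivative_at_withinI o_def)
  have "(curve K has_vector_derivative h' (M i t) ((1 / r i) *\<^sub>R d)) (at ?u)"
  proof (rule has_vector_derivative_transform_within_open[OF 3])
    show "open ((\<lambda>u. (u - c i) / r i) -` {-1<..<1})"
      by (rule open_vimage) (use r in \<open>auto intro!: continuous_intros\<close>)
    show "?u \<in> (\<lambda>u. (u - c i) / r i) -` {-1<..<1}" using t i by simp
    fix u assume "u \<in> (\<lambda>u. (u - c i) / r i) -` {-1<..<1}"
    then have "(u - c i) / r i \<in> {-1..1}" by auto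
    from curve_strand[OF i(1) this] show "(h \<circ> (M i \<circ> (\<lambda>u. (u - c i) / r i))) u = curve K u"
      using r by simp
  qed
  then show ?thesis
    unfolding velocity_def using vector_derivative_at linear_scale[OF has_derivative_linear[OF h]] by metis
qed

text \<open>The determinant of the derivative of \<open>h\<close> is positive and drops out. What
  remains is the sign in the standard picture, reversed once for each strand that the diagram
  follows backward.\<close>

lemma csign_strand:
  assumes h: "\<And>z. (h has_derivative h' z) (at z)" "\<And>z. 0 < wedge (h' z 1) (h' z \<i>)"
    and i: "i < n" "s \<in> {-1<..<1}" "(M i has_vector_derivative d) (at s)"
    and j: "j < n" "t \<in> {-1<..<1}" "(M j has_vector_derivative d') (at t)"
    and M: "M i s = M j t" and w: "wedge d d' \<noteq> 0"
  shows "csign K (c i + r i * s, c j + r j * t) =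
    (if 0 < r i then 1 else - 1) * (if 0 < r j then 1 else - 1) * (if 0 < wedge d d' then 1 else - 1)"
proof -
  let ?D = "wedge (h' (M j t) 1) (h' (M j t) \<i>)"
  have "wedge (velocity K (c i + r i * s)) (velocity K (c j + r j * t)) =
        (1 / r i) * (1 / r j) * (?D * wedge d d')"
    unfolding velocity_strand[OF h(1) i] velocity_strand[OF h(1) j] wedge_scaleR M
    using wedge_linear[OF has_derivative_linear[OF h(1)]] by metis
  moreover have "0 < (1 / r i) * (1 / r j) * (?D * wedge d d') \<longleftrightarrow>
      (0 < r i \<longleftrightarrow> (0 < r j \<longleftrightarrow> 0 < wedge d d'))"
    using h(2)[of "M j t"] w r_nonzero[OF i(1)] r_nonzero[OF j(1)]
    by (auto simp: zero_less_mult_iff mult_less_0_iff zero_less_divide_iff divide_less_0_iff)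
  ultimately show ?thesis by (simp add: csign_def)
qed

end

text \<open>The source of \<open>emb\<close>: congruent parameters have the same image, so a picture
  that rules out the coincidence rules out the congruence.\<close>

lemma strands_coincide:
  assumes K: "virtual_knot_diagram K" and "inj h" "looks_like K h n M c r"
    and "i < n" "j < n" "s \<in> {-1..1}" "t \<in> {-1..1}" "c i + r i * s - (c j + r j * t) \<in> \<int>"
  shows "M i s = M j t"
proof -
  have "h (M i s) = h (M j t)"
    using curve_cong_Ints[OF K assms(8)] assms unfolding looks_like_def by auto
  then show ?thesis using assms(2) by (simp add: inj_eq)
qed

lemma outer_rep_transfer:
  assumes K: "virtual_knot_diagram K"
    and off: "\<And>u. u \<notin> strand_params n c r \<Longrightarrow>
        curve K' u = curve K u \<and> (u \<in> overs K' \<longleftrightarrow> u \<in> overs K)"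
    and Y: "outer_rep K (strand_params n c r) Y"
  shows "outer_rep K' (strand_params n c r) Y"
    and "d \<in> Y \<Longrightarrow> csign K' d = csign K d"
proof -
  let ?S = "strand_params n c r"
  show "outer_rep K' ?S Y"
    unfolding outer_rep_def
  proof (intro conjI ballI impI)
    fix p assume "p \<in> overs K'" "p \<notin> ?S"
    then show "\<exists>!c. c \<in> Y \<and> p - fst c \<in> \<int>" using Y off unfolding outer_rep_def by blast
  qed (use Y off in \<open>auto simp: outer_rep_def double_params_def\<close>)
  assume "d \<in> Y"
  then have d: "fst d \<in> - ?S" "snd d \<in> - ?S" using Y unfolding outer_rep_def by blast+
  have "open (- ?S)" using closed_strand_params by (simp add: open_closed)
  then have "velocity K' (fst d) = velocity K (fst d)" "velocity K' (snd d) = velocity K (snd d)"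
    using velocity_cong_open[OF K _ d(1)] velocity_cong_open[OF K _ d(2)] off by blast+
  then show "csign K' d = csign K d" by (simp add: csign_def)
qed


section \<open>Reidemeister moves\<close>

lemma one_minus_square_bounds:
  fixes t :: real
  assumes "t \<in> {-1..1}"
  shows "0 \<le> 1 - t\<^sup>2" "1 - t\<^sup>2 \<le> 1" "0 \<le> (1 - t\<^sup>2)\<^sup>2" "(1 - t\<^sup>2)\<^sup>2 \<le> 1"
proof -
  show *: "0 \<le> 1 - t\<^sup>2" "1 - t\<^sup>2 \<le> 1" using assms by (auto simp: abs_square_le_1)
  show "0 \<le> (1 - t\<^sup>2)\<^sup>2" "(1 - t\<^sup>2)\<^sup>2 \<le> 1" using * by (auto simp: power_le_one)
qed

lemma one_minus_square_sq_eqD: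
  fixes s t :: real
  assumes "(1 - s\<^sup>2)\<^sup>2 = (1 - t\<^sup>2)\<^sup>2" "s \<in> {-1..1}" "t \<in> {-1..1}"
  shows "s = t \<or> s = - t"
proof -
  have "1 - s\<^sup>2 = 1 - t\<^sup>2"
    using assms one_minus_square_bounds(1) by (simp add: power2_eq_iff_nonneg)
  then show ?thesis by (simp add: power2_eq_iff)
qed

section \<open>First move: the kink\<close>

lemma R1_kink_box:
  assumes "t \<in> {-1..1}"
  shows "R1_kink i t \<in> cbox (Complex (- 1) (- 1)) (Complex 1 1)"
proof -
  have *: "\<bar>t - 4 * t * (1 - t\<^sup>2)\<^sup>2\<bar> \<le> 1" if t: "0 \<le> t" "t \<le> 1" for t :: real
  proof -
    \<comment> \<open>The subtracted term is \<open>1 + t\<close> times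
      \<open>4 * t * (1 - t)\<close> times \<open>(1 - t) * (1 + t)\<close>. The last two factors
      are at most 1, so the abscissa does not fall below -1.\<close>
    have "4 * t * (1 - t) \<le> 1" using zero_le_power2[of "2 * t - 1"] by (simp add: power2_eq_square algebra_simps)
    moreover have "0 \<le> (1 - t) * (1 + t)" "(1 - t) * (1 + t) \<le> 1"
      using t zero_le_square[of t] by (simp_all add: algebra_simps mult_le_one)
    ultimately have "(4 * t * (1 - t)) * ((1 - t) * (1 + t)) \<le> 1 * 1"
      using t by (intro mult_mono) auto
    then have "(1 + t) * ((4 * t * (1 - t)) * ((1 - t) * (1 + t))) \<le> (1 + t) * 1"
      using t by (intro mult_left_mono) auto
    moreover define x where "x = 4 * t * (1 - t\<^sup>2)\<^sup>2"
    moreover have "(1 + t) * ((4 * t * (1 - t)) * ((1 - t) * (1 + t))) = x"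
      unfolding x_def by (simp add: power2_eq_square algebra_simps)
    moreover have "0 \<le> x" unfolding x_def using t by simp
    ultimately show ?thesis using t unfolding x_def[symmetric] by auto
  qed
  have "\<bar>t - 4 * t * (1 - t\<^sup>2)\<^sup>2\<bar> \<le> 1"
  proof (cases "0 \<le> t")
    case False
    then show ?thesis using *[of "- t"] assms by (simp add: abs_minus_commute)
  qed (use * assms in auto)
  moreover have "- 1 \<le> w / 2 \<and> w / 2 \<le> 1" if "0 \<le> w" "w \<le> 1" for w :: real using that by simp
  note this[OF one_minus_square_bounds(3,4)[OF assms]]
  ultimately show ?thesis by (simp add: R1_kink_def in_cbox_complex_iff abs_le_iff)
qed

text \<open>The height determines the parameter up to sign, and the abscissa is odd, so it has to
  vanish at the crossing. Its zeros other than 0 satisfy \<open>(1 - t^2)^2 = 1/4\<close>.\<close>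

lemma R1_kink_self_crossing:
  assumes "R1_kink i s = R1_kink j t" "s \<in> {-1..1}" "t \<in> {-1..1}" "s \<noteq> t"
  shows "s = - t" "t\<^sup>2 = 1 / 2"
proof -
  have y: "(1 - s\<^sup>2)\<^sup>2 = (1 - t\<^sup>2)\<^sup>2"
    and x: "s - 4 * s * (1 - s\<^sup>2)\<^sup>2 = t - 4 * t * (1 - t\<^sup>2)\<^sup>2"
    using assms(1) by (auto simp: R1_kink_def)
  show s: "s = - t" using one_minus_square_sq_eqD[OF y] assms by blast
  then have "t \<noteq> 0" using assms by auto
  moreover have "t * (1 - 4 * (1 - t\<^sup>2)\<^sup>2) = 0" using x unfolding s by (simp add: algebra_simps)
  ultimately have "(1 - t\<^sup>2)\<^sup>2 = (1 / 2)\<^sup>2" by (simp add: power2_eq_square)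
  then have "1 - t\<^sup>2 = 1 / 2"
    using one_minus_square_bounds(1)[OF assms(3)] by (simp add: power2_eq_iff)
  then show "t\<^sup>2 = 1 / 2" by simp
qed

lemma affine_index_polynomial_reidemeister1:
  assumes K: "virtual_knot_diagram K" and K': "virtual_knot_diagram K'" and r1: "reidemeister1 K K'"
  shows "affine_index_polynomial K' = affine_index_polynomial K"
proof -
  obtain c r t where lm: "local_move K K' 1 R1_kink R1_flat c r"
      and t: "t \<in> {-1..1}" "c 0 + r 0 * t \<in> overs K"
    using r1 unfolding reidemeister1_def by blast
  obtain h where h: "orientation_preserving_diffeo h" "looks_like K h 1 R1_kink c r"
      "looks_like K' h 1 R1_flat c r"
    using lm unfolding local_move_def by blast
  have inj: "inj h"
    using h(1) unfolding orientation_preserving_diffeo_def C1_diffeo_def by (auto intro: bij_is_inj)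
  let ?S = "strand_params 1 c r"
  have off: "curve K' u = curve K u \<and> (u \<in> overs K' \<longleftrightarrow> u \<in> overs K)" if "u \<notin> ?S" for u
    using lm that unfolding local_move_def by blast
  \<comment> \<open>The flat picture of \<open>K'\<close> is injective, and both diagrams run
    through the strand with the same \<open>c\<close> and \<open>r\<close>.\<close>
  have emb: "i = j \<and> s = t" if "i < 1" "j < 1" "s \<in> {-1..1}" "t \<in> {-1..1}"
      "c i + r i * s - (c j + r j * t) \<in> \<int>" for i j s t
    using strands_coincide[OF K' inj h(3) that] that by (auto simp: R1_flat_def)
  interpret P: local_picture K h 1 R1_kink c r
    by unfold_locales (use K inj h R1_kink_box emb in auto)
  interpret P': local_picture K' h 1 R1_flat c r
    by unfold_locales (use K' inj h emb in \<open>auto simp: R1_flat_def in_cbox_complex_iff\<close>)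
  obtain Y where Y: "outer_rep K ?S Y" using P.outer_rep_exists by blast
  note Y' = outer_rep_transfer[OF K off Y]
  obtain q where q: "double_params K (c 0 + r 0 * t) q" using overs_partner[OF K] t by blast
  obtain s where s: "s \<in> {-1..1}" "R1_kink 0 t = R1_kink 0 s" "t \<noteq> s"
    using P.strand_double[OF _ t(1) q] by (metis less_one zero_less_one)
  have st: "t = - s" "s\<^sup>2 = 1 / 2" using R1_kink_self_crossing s t by blast+
  let ?p = "c 0 + r 0 * t" and ?q = "c 0 + r 0 * s"
  have dbl: "double_params K ?p ?q" using P.double_strand[of 0 0 t s] s t by simp
  have "gauss_rep K ({(?p, ?q)} \<union> Y)"
  proof (rule P.gauss_rep_Un_outer[OF Y])
    fix p assume "p \<in> overs K" "p \<in> ?S"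
    then obtain i j u v where uv: "i < 1" "j < (1::nat)" "u \<in> {-1..1}" "v \<in> {-1..1}"
        "p - (c i + r i * u) \<in> \<int>" "c i + r i * u \<in> overs K" "R1_kink i u = R1_kink j v" "i \<noteq> j \<or> u \<noteq> v"
      using P.strand_over by metis
    then have "u \<noteq> v" by auto
    then have "v = - u" "u\<^sup>2 = 1 / 2"
      using R1_kink_self_crossing[of j v i u] uv by auto
    \<comment> \<open>Only the two ends of the kink are left, and the end at \<open>s\<close> passes
      under.\<close>
    then have "u = s \<or> u = t" using st by (metis power2_eq_iff)
    moreover have "u \<noteq> s" using overs_not_both[OF K t(2) dbl] uv by auto
    ultimately show "\<exists>d\<in>{(?p, ?q)}. p - fst d \<in> \<int>" using uv by auto
  qed (use t dbl in \<open>auto simp: mem_strand_params_iff intro!: exI[of _ 0] bexI[of _ t]\<close>)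
  then have "affine_index_polynomial K = gauss_poly (csign K) ({(?p, ?q)} \<union> Y)"
    by (rule affine_index_polynomial_eq[OF K])
  also have "\<dots> = gauss_poly (csign K) Y"
  proof -
    have A: "avoids Y (strand c r 0)" using P.avoids_outer[OF Y] by simp
    have "?p \<in> strand c r 0" "?q \<in> strand c r 0" using mem_strandI t(1) s(1) by blast+
    moreover from this have "(?p, ?q) \<notin> Y" using avoidsD(1)[OF A, of "(?p, ?q)" ?p] by auto
    moreover have "?p - ?q \<notin> \<int>" using P.strand_diff_notin_Ints[OF _ t(1) s(1,3)] by blast
    moreover have "finite Y" using Y unfolding outer_rep_def by blast
    ultimately have "gauss_poly (csign K) (insert (?p, ?q) Y) = gauss_poly (csign K) Y"
      using gauss_poly_kink A convex_strand by blast
    then show ?thesis by simp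
  qed
  also have "\<dots> = gauss_poly (csign K') ({} \<union> Y)"
    unfolding Un_empty_left by (rule gauss_poly_cong[symmetric]) (rule Y'(2))
  also have "\<dots> = affine_index_polynomial K'"
  proof (rule affine_index_polynomial_eq[OF K', symmetric], rule P'.gauss_rep_Un_outer[OF Y'(1)])
    fix p assume "p \<in> overs K'" "p \<in> ?S"
    then obtain i j u v where "i < 1" "j < (1::nat)" "R1_flat i u = R1_flat j v" "i \<noteq> j \<or> u \<noteq> v"
      using P'.strand_over by metis
    then show "\<exists>d\<in>{}. p - fst d \<in> \<int>" by (auto simp: R1_flat_def)
  qed auto
  finally show ?thesis by simp
qed

section \<open>Second move: the bigon\<close>

definition bigon_param :: real where
  "bigon_param = sqrt (1 - 1 / sqrt 2)"

text \<open>The two arcs are mirror images in the horizontal axis, so they cross where their height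
  vanishes, that is where \<open>(1 - t^2)^2 = 1/2\<close>; this explains the nested roots.\<close>

lemma bigon_param: "0 < bigon_param" "bigon_param < 1" "(1 - bigon_param\<^sup>2)\<^sup>2 = 1 / 2"
proof -
  have "1 < sqrt 2" by (simp add: real_less_rsqrt)
  then have s: "0 < 1 - 1 / sqrt 2" "1 - 1 / sqrt 2 < 1" by simp_all
  then show "0 < bigon_param" "bigon_param < 1" by (simp_all add: bigon_param_def)
  have "bigon_param\<^sup>2 = 1 - 1 / sqrt 2" using s by (simp add: bigon_param_def)
  then show "(1 - bigon_param\<^sup>2)\<^sup>2 = 1 / 2" by (simp add: power_divide)
qed

lemma R2_crossing_eq_iff:
  assumes ij: "i < 2" "j < 2" and st: "s \<in> {-1..1}" "t \<in> {-1..1}"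
  shows "R2_crossing i s = R2_crossing j t \<and> (i \<noteq> j \<or> s \<noteq> t) \<longleftrightarrow>
     i \<noteq> j \<and> s = t \<and> (t = bigon_param \<or> t = - bigon_param)"
proof -
  \<comment> \<open>The abscissa is the parameter, so strands meet at equal parameters only.\<close>
  have x: "s = t" if "R2_crossing i s = R2_crossing j t"
    using that by (auto simp: R2_crossing_def split: if_splits)
  have y: "R2_crossing i t = R2_crossing j t \<longleftrightarrow> (1 - t\<^sup>2)\<^sup>2 = 1 / 2" if "i \<noteq> j"
    using that ij by (auto simp: R2_crossing_def)
  have "(1 - t\<^sup>2)\<^sup>2 = 1 / 2 \<longleftrightarrow> t = bigon_param \<or> t = - bigon_param"
    using one_minus_square_sq_eqD[of t bigon_param] bigon_param st by auto
  then show ?thesis using x y by blast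
qed

lemma R2_crossing_deriv:
  "(R2_crossing i has_vector_derivative
     Complex 1 ((if i = 0 then 1 else - 1) * (4 * t * (1 - t\<^sup>2)))) (at t)"
  unfolding has_vector_derivative_complex_iff R2_crossing_def
  by (auto intro!: derivative_eq_intros simp: algebra_simps power2_eq_square)

lemma R2_box:
  assumes "t \<in> {-1..1}"
  shows "R2_crossing i t \<in> cbox (Complex (- 1) (- 1)) (Complex 1 1)"
    "R2_parallel i t \<in> cbox (Complex (- 1) (- 1)) (Complex 1 1)"
proof -
  obtain w where w: "w = (1 - t\<^sup>2)\<^sup>2" "0 \<le> w" "w \<le> 1"
    using one_minus_square_bounds(3,4)[OF assms] by blast
  show "R2_crossing i t \<in> cbox (Complex (- 1) (- 1)) (Complex 1 1)"
    "R2_parallel i t \<in> cbox (Complex (- 1) (- 1)) (Complex 1 1)"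
    using assms w(2,3)
    unfolding R2_crossing_def R2_parallel_def in_cbox_complex_iff w(1)[symmetric] by auto
qed

lemma affine_index_polynomial_reidemeister2:
  assumes K: "virtual_knot_diagram K" and K': "virtual_knot_diagram K'" and r2: "reidemeister2 K K'"
  shows "affine_index_polynomial K' = affine_index_polynomial K"
proof -
  obtain c r ht where lm: "local_move K K' 2 R2_crossing R2_parallel c r"
      and ht: "inj_on ht {..<2}" and lay: "layered K 2 R2_crossing c r ht"
    using r2 unfolding reidemeister2_def by blast
  obtain h where h: "orientation_preserving_diffeo h" "looks_like K h 2 R2_crossing c r"
      "looks_like K' h 2 R2_parallel c r"
    using lm unfolding local_move_def by blast
  obtain h' where h': "bij h" "\<And>z. (h has_derivative h' z) (at z)" "\<And>z. 0 < wedge (h' z 1) (h' z \<i>)"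
    using h(1) unfolding orientation_preserving_diffeo_def C1_diffeo_def by blast
  have inj: "inj h" using h'(1) by (rule bij_is_inj)
  let ?S = "strand_params 2 c r"
  have off: "curve K' u = curve K u \<and> (u \<in> overs K' \<longleftrightarrow> u \<in> overs K)" if "u \<notin> ?S" for u
    using lm that unfolding local_move_def by blast
  have par: "i = j \<and> s = t" if "R2_parallel i s = R2_parallel j t" "i < 2" "j < 2" for i j s t
    using that by (auto simp: R2_parallel_def split: if_splits)
  have emb: "i = j \<and> s = t" if "i < 2" "j < 2" "s \<in> {-1..1}" "t \<in> {-1..1}"
      "c i + r i * s - (c j + r j * t) \<in> \<int>" for i j s t
    using par strands_coincide[OF K' inj h(3) that] that by blast
  interpret P: local_picture K h 2 R2_crossing c r
    by unfold_locales (use K inj h R2_box emb in auto)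
  interpret P': local_picture K' h 2 R2_parallel c r
    by unfold_locales (use K' inj h emb R2_box in auto)
  obtain Y where Y: "outer_rep K ?S Y" using P.outer_rep_exists by blast
  note Y' = outer_rep_transfer[OF K off Y]
  have "ht 0 \<noteq> ht 1" using ht unfolding inj_on_def by force
  then consider "ht 0 < ht 1" | "ht 1 < ht 0" by linarith
  \<comment> \<open>From here on \<open>i\<close> is the upper and \<open>j\<close> the lower
    strand, whichever of the two arcs that is.\<close>
  then obtain i j :: nat where ij: "i < 2" "j < 2" "i \<noteq> j" "ht j < ht i"
    by cases (use that[of 1 0] that[of 0 1] in auto)
  then have less2: "k = i \<or> k = j" if "k < 2" for k using that by auto
  define a where "a = bigon_param"
  have a: "0 < a" "a < 1" "a \<in> {-1..1}" "- a \<in> {-1..1}" using bigon_param by (auto simp: a_def)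
  note cross = R2_crossing_eq_iff[folded a_def]
  have eq: "R2_crossing i s = R2_crossing j s" if "s = a \<or> s = - a" for s
    using cross[OF ij(1,2), of s s] that ij a by auto
  have over: "c i + r i * s \<in> overs K \<and> c j + r j * s \<notin> overs K" if "s = a \<or> s = - a" for s
    using lay ij eq[OF that] a that unfolding layered_def by (metis less_not_sym)
  have dbl: "double_params K (c i + r i * s) (c j + r j * s)" if "s = a \<or> s = - a" for s
    using P.double_strand[OF ij(1,2), of s s] eq[OF that] ij(3) a that by blast
  let ?Z = "{(c i + r i * a, c j + r j * a), (c i + r i * (- a), c j + r j * (- a))}"
  have "gauss_rep K (?Z \<union> Y)"
  proof (rule P.gauss_rep_Un_outer[OF Y])
    fix d assume "d \<in> ?Z"
    then obtain s where s: "s = a \<or> s = - a" "d = (c i + r i * s, c j + r j * s)" by blast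
    then show "fst d \<in> overs K \<and> double_params K (fst d) (snd d)" using over dbl by simp
    have "s \<in> {-1..1}" using s a by auto
    moreover have "fst d - (c i + r i * s) \<in> \<int>" using s by simp
    ultimately show "fst d \<in> ?S" using ij(1) unfolding mem_strand_params_iff by blast
    fix d' assume d': "d' \<in> ?Z" "fst d - fst d' \<in> \<int>"
    then obtain s' where s': "s' = a \<or> s' = - a" "d' = (c i + r i * s', c j + r j * s')" by blast
    have "s = s'"
      by (rule conjunct2[OF P.emb[OF ij(1) ij(1)]]) (use s s' a d'(2) in auto)
    then show "d = d'" using s s' by simp
  next
    fix p assume "p \<in> overs K" "p \<in> ?S"
    then obtain i' j' u v where uv: "i' < 2" "j' < 2" "u \<in> {-1..1}" "v \<in> {-1..1}"
        "p - (c i' + r i' * u) \<in> \<int>" "c i' + r i' * u \<in> overs K"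
        "R2_crossing i' u = R2_crossing j' v" "i' \<noteq> j' \<or> u \<noteq> v"
      by (rule P.strand_over)
    then have u: "i' \<noteq> j' \<and> u = v \<and> (v = a \<or> v = - a)" using cross by blast
    then have "i' = i" using over less2 uv by metis
    then show "\<exists>d\<in>?Z. p - fst d \<in> \<int>" using uv u by auto
  qed simp
  then have "affine_index_polynomial K = gauss_poly (csign K) (?Z \<union> Y)"
    by (rule affine_index_polynomial_eq[OF K])
  also have "\<dots> = gauss_poly (csign K) Y"
  proof (rule gauss_poly_bigon[where A = "strand c r i" and B = "strand c r j"])
    show "finite Y" using Y unfolding outer_rep_def by blast
    show "avoids Y (strand c r i)" "avoids Y (strand c r j)" using P.avoids_outer[OF Y] ij by blast+
    show "c i + r i * a - (c i + r i * (- a)) \<notin> \<int>" "c j + r j * a - (c j + r j * (- a)) \<notin> \<int>"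
      using P.strand_diff_notin_Ints[OF ij(1) a(3,4)] P.strand_diff_notin_Ints[OF ij(2) a(3,4)] a(1)
      by simp_all
    \<comment> \<open>The value is 2 or -2, according to which arc lies above.\<close>
    define w where "w = (if i = 0 then 1 else - 1) - (if j = 0 then 1 else (- 1 :: real))"
    have w: "w \<noteq> 0" using ij by (auto simp: w_def)
    define D where "D = (\<lambda>k t. Complex 1 ((if k = (0::nat) then 1 else - 1) * (4 * t * (1 - t\<^sup>2))))"
    have wedge: "wedge (D i t) (D j t) = - (w * (4 * t * (1 - t\<^sup>2)))" for t
      by (simp add: wedge_def D_def w_def algebra_simps)
    have "0 < 1 - a\<^sup>2" using a by (simp add: abs_square_less_1)
    then have pos: "0 < 4 * a * (1 - a\<^sup>2)" using a by simp
    have sg: "csign K (c i + r i * s, c j + r j * s) = (if 0 < r i then 1 else - 1) *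
        (if 0 < r j then 1 else - 1) * (if 0 < wedge (D i s) (D j s) then 1 else - 1)"
      if s: "s = a \<or> s = - a" for s
      unfolding D_def
    proof (rule P.csign_strand[OF h'(2,3) ij(1) _ R2_crossing_deriv ij(2) _ R2_crossing_deriv eq[OF s]])
      have "wedge (D i s) (D j s) \<noteq> 0" using s pos w unfolding wedge by auto
      then show "wedge (Complex 1 ((if i = 0 then 1 else - 1) * (4 * s * (1 - s\<^sup>2))))
          (Complex 1 ((if j = 0 then 1 else - 1) * (4 * s * (1 - s\<^sup>2)))) \<noteq> 0"
        unfolding D_def .
    qed (use s a in auto)
    \<comment> \<open>The slopes are odd in the parameter, so the crossings at \<open>a\<close> and
      \<open>- a\<close> have opposite signs.\<close>
    have "wedge (D i (- a)) (D j (- a)) = - wedge (D i a) (D j a)" unfolding wedge by simp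
    moreover have "wedge (D i a) (D j a) \<noteq> 0" using pos w unfolding wedge by auto
    ultimately show "csign K (c i + r i * (- a), c j + r j * (- a)) = - csign K (c i + r i * a, c j + r j * a)"
      using sg[of a] sg[of "- a"] by simp
    show "c i + r i * a \<in> strand c r i" "c i + r i * (- a) \<in> strand c r i"
      "c j + r j * a \<in> strand c r j" "c j + r j * (- a) \<in> strand c r j"
      using a by (intro mem_strandI; simp)+
  qed (use ij convex_strand P.strand_disjoint in auto)
  also have "\<dots> = gauss_poly (csign K') ({} \<union> Y)"
    unfolding Un_empty_left by (rule gauss_poly_cong[symmetric]) (rule Y'(2))
  also have "\<dots> = affine_index_polynomial K'"
  proof (rule affine_index_polynomial_eq[OF K', symmetric], rule P'.gauss_rep_Un_outer[OF Y'(1)])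
    fix p assume "p \<in> overs K'" "p \<in> ?S"
    then obtain i j u v where "i < 2" "j < 2" "R2_parallel i u = R2_parallel j v" "i \<noteq> j \<or> u \<noteq> v"
      using P'.strand_over by metis
    then show "\<exists>d\<in>{}. p - fst d \<in> \<int>" using par by blast
  qed auto
  finally show ?thesis by simp
qed


section \<open>Third move: the triangle\<close>

lemma triangle_param_exists: "\<exists>a::real. 0 < a \<and> a < 1 \<and> (1 - a\<^sup>2)\<^sup>2 = 2 * a"
proof -
  have "\<exists>a\<ge>0. a \<le> 1 \<and> 2 * a - (1 - a\<^sup>2)\<^sup>2 = (0::real)"
    by (rule IVT') (auto intro!: continuous_intros)
  then obtain a :: real where "0 \<le> a" "a \<le> 1" "(1 - a\<^sup>2)\<^sup>2 = 2 * a" by auto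
  moreover from this have "a \<noteq> 0" "a \<noteq> 1" by auto
  ultimately show ?thesis by (intro exI[of _ a]) simp
qed

text \<open>The parameter at which the arc of height \<open>(1 - t^2)^2 / 2\<close> meets the
  diagonal strand of height \<open>t\<close>.\<close>

definition triangle_param :: real where
  "triangle_param = (SOME a. 0 < a \<and> a < 1 \<and> (1 - a\<^sup>2)\<^sup>2 = 2 * a)"

lemma triangle_param:
  "0 < triangle_param" "triangle_param < 1" "(1 - triangle_param\<^sup>2)\<^sup>2 = 2 * triangle_param"
  using someI_ex[OF triangle_param_exists] unfolding triangle_param_def by blast+

text \<open>The equation forces \<open>t \<ge> 0\<close>, and on \<open>[0,1]\<close> its left side
  decreases while its right side increases.\<close>

lemma triangle_param_unique:
  assumes "t \<in> {-1..1}" "(1 - t\<^sup>2)\<^sup>2 = 2 * t"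
  shows "t = triangle_param"
proof -
  have less: False if "0 \<le> s" "s < t" "t \<le> 1" "(1 - s\<^sup>2)\<^sup>2 = 2 * s" "(1 - t\<^sup>2)\<^sup>2 = 2 * t" for s t :: real
  proof -
    have "s\<^sup>2 \<le> t\<^sup>2" "t\<^sup>2 \<le> 1" using that by (auto intro: power_mono simp: power_le_one)
    then have "(1 - t\<^sup>2)\<^sup>2 \<le> (1 - s\<^sup>2)\<^sup>2" by (intro power_mono) auto
    then show False using that by simp
  qed
  have "0 \<le> t" using assms(2) zero_le_power2[of "1 - t\<^sup>2"] by linarith
  then show ?thesis
    using less[of t triangle_param] less[of triangle_param t] triangle_param assms by fastforce
qed

text \<open>The common parameter of the crossing of strands \<open>i\<close> and \<open>j\<close> in the picture \<open>R3_above\<close>; in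
  \<open>R3_below\<close> it changes its sign.\<close>

definition R3_param :: "nat \<Rightarrow> nat \<Rightarrow> real" where
  "R3_param i j = (if i \<noteq> 2 \<and> j \<noteq> 2 then 0 else if i = 0 \<or> j = 0 then triangle_param else - triangle_param)"

text \<open>The sign of the wedge of the two directions at the crossing: -1 exactly if strand
  \<open>i\<close> has the larger signed slope there. At their crossings, the slopes decrease in the
  order 0, 2, 1.\<close>

definition R3_sign :: "nat \<Rightarrow> nat \<Rightarrow> int" where
  "R3_sign i j = (if (i, j) \<in> {(0, 1), (0, 2), (2, 1)} then - 1 else 1)"

definition R3_deriv :: "nat \<Rightarrow> real \<Rightarrow> complex" where
  "R3_deriv i t = (if i = 0 then Complex 1 1 else if i = 1 then Complex 1 (- 1)
                   else Complex 1 (- (2 * t * (1 - t\<^sup>2))))"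

lemma R3_param_sym: "R3_param i j = R3_param j i"
  by (auto simp: R3_param_def)

lemma R3_param_mem: "R3_param i j \<in> {-1<..<1}"
  using triangle_param by (auto simp: R3_param_def)

lemma less_3_cases: "(i::nat) < 3 \<Longrightarrow> i = 0 \<or> i = 1 \<or> i = 2"
  by auto

lemma R3_above_eq_iff:
  assumes ij: "i < 3" "j < 3" and st: "s \<in> {-1..1}" "t \<in> {-1..1}"
  shows "R3_above i s = R3_above j t \<and> (i \<noteq> j \<or> s \<noteq> t) \<longleftrightarrow> i \<noteq> j \<and> s = t \<and> t = R3_param i j"
proof -
  have x: "s = t" if "R3_above i s = R3_above j t"
    using that by (auto simp: R3_above_def split: if_splits)
  have 1: "(1 - t\<^sup>2)\<^sup>2 = 2 * t \<longleftrightarrow> t = triangle_param"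
    using triangle_param_unique st(2) triangle_param by blast
  have 2: "(1 - t\<^sup>2)\<^sup>2 = - 2 * t \<longleftrightarrow> t = - triangle_param"
    using triangle_param_unique[of "- t"] st(2) triangle_param by auto
  have "R3_above i t = R3_above j t \<longleftrightarrow> t = R3_param i j" if "i \<noteq> j"
    using that less_3_cases[OF ij(1)] less_3_cases[OF ij(2)] 1 2
    by (elim disjE) (auto simp: R3_above_def R3_param_def)
  then show ?thesis using x by blast
qed

lemma R3_below_eq_iff:
  assumes ij: "i < 3" "j < 3" and st: "s \<in> {-1..1}" "t \<in> {-1..1}"
  shows "R3_below i s = R3_below j t \<and> (i \<noteq> j \<or> s \<noteq> t) \<longleftrightarrow> i \<noteq> j \<and> s = t \<and> t = - R3_param i j"
proof -
  have x: "s = t" if "R3_below i s = R3_below j t"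
    using that by (auto simp: R3_below_def split: if_splits)
  have 1: "(1 - t\<^sup>2)\<^sup>2 = 2 * t \<longleftrightarrow> t = triangle_param"
    using triangle_param_unique st(2) triangle_param by blast
  have 2: "(1 - t\<^sup>2)\<^sup>2 = - 2 * t \<longleftrightarrow> t = - triangle_param"
    using triangle_param_unique[of "- t"] st(2) triangle_param by auto
  have "R3_below i t = R3_below j t \<longleftrightarrow> t = - R3_param i j" if "i \<noteq> j"
    using that less_3_cases[OF ij(1)] less_3_cases[OF ij(2)] 1 2
    by (elim disjE) (auto simp: R3_below_def R3_param_def)
  then show ?thesis using x by blast
qed

lemma R3_above_deriv: "(R3_above i has_vector_derivative R3_deriv i t) (at t)"
  unfolding has_vector_derivative_complex_iff R3_above_def R3_deriv_def
  by (auto intro!: derivative_eq_intros simp: field_simps power2_eq_square)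

text \<open>Crossing parameters change sign between the pictures, and so does the argument of
  \<open>R3_deriv\<close>. Hence the directions at corresponding crossings, and with them the signs,
  are the same.\<close>

lemma R3_below_deriv: "(R3_below i has_vector_derivative R3_deriv i (- t)) (at t)"
  unfolding has_vector_derivative_complex_iff R3_below_def R3_deriv_def
  by (auto intro!: derivative_eq_intros simp: field_simps power2_eq_square)

lemma R3_box:
  assumes "t \<in> {-1..1}"
  shows "R3_above i t \<in> cbox (Complex (- 1) (- 1)) (Complex 1 1)"
    "R3_below i t \<in> cbox (Complex (- 1) (- 1)) (Complex 1 1)"
proof -
  obtain w where w: "w = (1 - t\<^sup>2)\<^sup>2" "0 \<le> w" "w \<le> 1"
    using one_minus_square_bounds(3,4)[OF assms] by blast
  show "R3_above i t \<in> cbox (Complex (- 1) (- 1)) (Complex 1 1)"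
    "R3_below i t \<in> cbox (Complex (- 1) (- 1)) (Complex 1 1)"
    using assms w(2,3)
    unfolding R3_above_def R3_below_def in_cbox_complex_iff w(1)[symmetric] by auto
qed

lemma R3_wedge:
  assumes "i < 3" "j < 3" "i \<noteq> j"
  defines "w \<equiv> wedge (R3_deriv i (R3_param i j)) (R3_deriv j (R3_param i j))"
  shows "w \<noteq> 0" "(if 0 < w then 1 else - 1) = R3_sign i j"
proof -
  \<comment> \<open>The absolute slope of strand 2 at its two crossings.\<close>
  define x where "x = 2 * triangle_param * (1 - triangle_param\<^sup>2)"
  have "triangle_param\<^sup>2 < 1" using triangle_param(1,2) by (simp add: abs_square_less_1)
  then have x: "0 < x" unfolding x_def using triangle_param(1) by simp
  have *: "w = (if i \<noteq> 2 \<and> j \<noteq> 2 then 2 * of_int (R3_sign i j) else (1 + x) * of_int (R3_sign i j))"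
    using less_3_cases[OF assms(1)] less_3_cases[OF assms(2)] assms(3)
    by (elim disjE) (auto simp: w_def R3_deriv_def R3_param_def wedge_def R3_sign_def x_def)
  show "w \<noteq> 0" using x unfolding * by (auto simp: R3_sign_def)
  show "(if 0 < w then 1 else - 1) = R3_sign i j" using x unfolding * by (auto simp: R3_sign_def)
qed

lemma R3_param_neq:
  assumes "i < 3" "j < 3" "k < 3" "i \<noteq> j" "i \<noteq> k" "j \<noteq> k"
  shows "R3_param i j \<noteq> R3_param i k"
  using less_3_cases[OF assms(1)] less_3_cases[OF assms(2)] less_3_cases[OF assms(3)] assms(4-6)
    triangle_param(1)
  by (elim disjE) (auto simp: R3_param_def)

text \<open>\<open>o1\<close>, \<open>o2\<close>, \<open>o3\<close> record the order of the two
  crossings along each strand. Their relation to the crossing signs is what \<open>tri\<close> in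
  \<open>gauss_poly_triangle\<close> asks for, once the directions of traversal are factored out;
  six arrangements of the strands are inspected.\<close>

lemma R3_sign_order:
  assumes "i < 3" "j < 3" "k < 3" "i \<noteq> j" "i \<noteq> k" "j \<noteq> k"
  defines "o1 \<equiv> if R3_param i j < R3_param i k then 1 else - 1"
    and "o2 \<equiv> if R3_param j i < R3_param j k then 1 else - 1"
    and "o3 \<equiv> if R3_param k i < R3_param k j then 1 else - 1"
  shows "R3_sign i k * o1 = R3_sign j k * o2 \<and> R3_sign i j * o1 = R3_sign j k * o3 \<and>
    R3_sign i j * o2 = R3_sign i k * o3"
  using less_3_cases[OF assms(1)] less_3_cases[OF assms(2)] less_3_cases[OF assms(3)] assms(4-6)
    triangle_param(1)
  by (elim disjE) (auto simp: R3_param_def R3_sign_def o1_def o2_def o3_def)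

text \<open>Stated for any table \<tau> of crossing parameters so that it covers both pictures, with
  \<open>R3_param\<close> and its negative. Sorting the strands by height makes every listed pair
  start with its over-parameter.\<close>

lemma (in local_picture) gauss_rep_triangle:
  assumes n: "n = 3"
    and lay: "layered K 3 M c r ht"
    and cross: "\<And>i j s t. i < 3 \<Longrightarrow> j < 3 \<Longrightarrow> s \<in> {-1..1} \<Longrightarrow> t \<in> {-1..1} \<Longrightarrow>
      M i s = M j t \<and> (i \<noteq> j \<or> s \<noteq> t) \<longleftrightarrow> i \<noteq> j \<and> s = t \<and> t = \<tau> i j"
    and \<tau>: "\<And>i j. \<tau> i j \<in> {-1..1}" "\<And>i j. \<tau> i j = \<tau> j i"
      "\<And>i j k. i < 3 \<Longrightarrow> j < 3 \<Longrightarrow> k < 3 \<Longrightarrow> i \<noteq> j \<Longrightarrow> i \<noteq> k \<Longrightarrow> j \<noteq> k \<Longrightarrow> \<tau> i j \<noteq> \<tau> i k"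
    and xyz: "x < 3" "y < 3" "z < 3" "ht z < ht y" "ht y < ht x"
    and Y: "outer_rep K (strand_params 3 c r) Y"
  shows "gauss_rep K ({(c x + r x * \<tau> x y, c y + r y * \<tau> x y), (c x + r x * \<tau> x z, c z + r z * \<tau> x z),
      (c y + r y * \<tau> y z, c z + r z * \<tau> y z)} \<union> Y)"
    (is "gauss_rep K (?Z \<union> Y)")
proof (rule gauss_rep_Un_outer)
  show "outer_rep K (strand_params n c r) Y" using Y n by simp
  have ne: "x \<noteq> y" "x \<noteq> z" "y \<noteq> z" using xyz by auto
  have eq: "M i (\<tau> i j) = M j (\<tau> i j)" if "i < 3" "j < 3" "i \<noteq> j" for i j
    using cross[OF that(1,2) \<tau>(1) \<tau>(1), of i j i j] that(3) by blast
  have over: "c i + r i * \<tau> i j \<in> overs K \<longleftrightarrow> ht j < ht i" if "i < 3" "j < 3" "i \<noteq> j" for i j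
    using lay eq[OF that] that \<tau>(1) unfolding layered_def by blast
  let ?I = "{(x, y), (x, z), (y, z)}"
  let ?f = "\<lambda>(i, j). (c i + r i * \<tau> i j, c j + r j * \<tau> i j)"
  have Z: "?Z = ?f ` ?I" by simp
  have I: "i < 3 \<and> j < 3 \<and> i \<noteq> j \<and> ht j < ht i" if "(i, j) \<in> ?I" for i j using that xyz by auto
  show "finite ?Z" by simp
  fix d assume d: "d \<in> ?Z"
  then obtain i j where ij: "(i, j) \<in> ?I" "d = ?f (i, j)" unfolding Z by blast
  note i3 = I[OF ij(1)]
  show "fst d \<in> overs K \<and> double_params K (fst d) (snd d)"
    using ij(2) over[of i j] double_strand[of i j "\<tau> i j" "\<tau> i j"] eq[of i j] \<tau>(1) i3 n by simp
  show "fst d \<in> strand_params n c r"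
    unfolding mem_strand_params_iff using ij(2) i3 \<tau>(1) n
    by (intro exI[of _ i] conjI bexI[of _ "\<tau> i j"]) auto
  fix d' assume d': "d' \<in> ?Z" "fst d - fst d' \<in> \<int>"
  then obtain i' j' where ij': "(i', j') \<in> ?I" "d' = ?f (i', j')" unfolding Z by blast
  note i3' = I[OF ij'(1)]
  \<comment> \<open>Congruent over-ends lie on one strand at one parameter, and the two crossings on
    a strand have different parameters, so the other strands agree too.\<close>
  have "i = i' \<and> \<tau> i j = \<tau> i' j'"
    by (rule emb) (use i3 i3' n \<tau>(1) d'(2) ij(2) ij'(2) in auto)
  then have "i = i' \<and> j = j'" using \<tau>(3)[of i j j'] i3 i3' by metis
  then show "d = d'" using ij ij' by simp
next
  fix p assume "p \<in> overs K" "p \<in> strand_params n c r"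
  then obtain i j u v where uv: "i < n" "j < n" "u \<in> {-1..1}" "v \<in> {-1..1}"
      "p - (c i + r i * u) \<in> \<int>" "c i + r i * u \<in> overs K" "M i u = M j v" "i \<noteq> j \<or> u \<noteq> v"
    by (rule strand_over)
  then have u: "i \<noteq> j \<and> u = v \<and> v = \<tau> i j" using cross[of i j u v] n by blast
  then have "c i + r i * \<tau> i j \<in> overs K" using uv by blast
  moreover have "M i (\<tau> i j) = M j (\<tau> i j)" using uv u by blast
  ultimately have "ht j < ht i" using lay u uv n \<tau>(1) unfolding layered_def by blast
  moreover have "k = x \<or> k = y \<or> k = z" if "k < 3" for k
  proof -
    have "x \<noteq> y" "x \<noteq> z" "y \<noteq> z" using xyz by auto
    then show ?thesis using that xyz by linarith
  qed
  then have "i = x \<or> i = y \<or> i = z" "j = x \<or> j = y \<or> j = z" using uv n by blast+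
  ultimately consider "i = x" "j = y" | "i = x" "j = z" | "i = y" "j = z"
    using xyz by fastforce
  then show "\<exists>d\<in>?Z. p - fst d \<in> \<int>"
    using uv(5) u by cases auto
qed

lemma affine_index_polynomial_reidemeister3:
  assumes K: "virtual_knot_diagram K" and K': "virtual_knot_diagram K'" and r3: "reidemeister3 K K'"
  shows "affine_index_polynomial K' = affine_index_polynomial K"
proof -
  obtain c r ht where lm: "local_move K K' 3 R3_above R3_below c r"
      and ht: "inj_on ht {..<3}" and lay: "layered K 3 R3_above c r ht" "layered K' 3 R3_below c r ht"
    using r3 unfolding reidemeister3_def by blast
  obtain h where h: "orientation_preserving_diffeo h" "looks_like K h 3 R3_above c r"
      "looks_like K' h 3 R3_below c r"
    using lm unfolding local_move_def by blast
  obtain h' where h': "bij h" "\<And>z. (h has_derivative h' z) (at z)" "\<And>z. 0 < wedge (h' z 1) (h' z \<i>)"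
    using h(1) unfolding orientation_preserving_diffeo_def C1_diffeo_def by blast
  have inj: "inj h" using h'(1) by (rule bij_is_inj)
  let ?S = "strand_params 3 c r"
  have off: "curve K' u = curve K u \<and> (u \<in> overs K' \<longleftrightarrow> u \<in> overs K)" if "u \<notin> ?S" for u
    using lm that unfolding local_move_def by blast
  have r: "r i \<noteq> 0" if "i < 3" for i using h(2) that unfolding looks_like_def by blast
  text \<open>Two strands coinciding along a common parameter would cross at more than one point.\<close>
  have emb: "i = j \<and> s = t" if ij: "i < 3" "j < 3" and st: "s \<in> {-1..1}" "t \<in> {-1..1}"
      and Z: "c i + r i * s - (c j + r j * t) \<in> \<int>" for i j s t
  proof (rule ccontr)
    assume ne: "\<not> (i = j \<and> s = t)"
    have co: "i \<noteq> j \<and> s = t \<and> t = R3_param i j \<and> t = - R3_param i j"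
      if "s \<in> {-1..1}" "t \<in> {-1..1}" "c i + r i * s - (c j + r j * t) \<in> \<int>" "i \<noteq> j \<or> s \<noteq> t" for s t
      using strands_coincide[OF K inj h(2) ij that(1-3)] strands_coincide[OF K' inj h(3) ij that(1-3)]
        R3_above_eq_iff[OF ij that(1,2)] R3_below_eq_iff[OF ij that(1,2)] that(4) by blast
    \<comment> \<open>The crossing of \<open>i\<close> and \<open>j\<close> would have this
      parameter in both pictures, but it changes sign between them, so it is 0.\<close>
    have 0: "i \<noteq> j" "s = 0" "t = 0" using co[OF st Z] ne by auto
    \<comment> \<open>One unit along strand \<open>i\<close> matches \<open>r i / r j\<close> units
      along strand \<open>j\<close>, so the congruence persists along both. Going to the end of the
      strand with the smaller \<open>\<bar>r\<bar>\<close> keeps the other parameter in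
      \<open>{-1..1}\<close> and yields a second coincidence, away from 0.\<close>
    show False
    proof (cases "\<bar>r i\<bar> \<le> \<bar>r j\<bar>")
      case True
      then have "\<bar>r i / r j\<bar> \<le> 1" using r ij by (simp add: abs_divide)
      then have "r i / r j \<in> {-1..1}" unfolding abs_le_iff by simp
      moreover have "c i + r i * 1 - (c j + r j * (r i / r j)) \<in> \<int>" using Z 0 r ij by simp
      ultimately have "(1::real) = 0" using co[of 1 "r i / r j"] 0 by auto
      then show False by simp
    next
      case False
      then have "\<bar>r j / r i\<bar> \<le> 1" using r ij by (simp add: abs_divide)
      then have "r j / r i \<in> {-1..1}" unfolding abs_le_iff by simp
      moreover have "c i + r i * (r j / r i) - (c j + r j * 1) \<in> \<int>" using Z 0 r ij by simp
      ultimately have "(1::real) = 0" using co[of "r j / r i" 1] 0 by auto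
      then show False by simp
    qed
  qed
  interpret P: local_picture K h 3 R3_above c r
    by unfold_locales (use K inj h R3_box emb in auto)
  interpret P': local_picture K' h 3 R3_below c r
    by unfold_locales (use K' inj h emb R3_box in auto)
  obtain Y where Y: "outer_rep K ?S Y" using P.outer_rep_exists by blast
  note Y' = outer_rep_transfer[OF K off Y]
  have "ht 0 \<noteq> ht 1" "ht 0 \<noteq> ht 2" "ht 1 \<noteq> ht 2" using ht unfolding inj_on_def by force+
  then consider "ht 0 < ht 1" "ht 1 < ht 2" | "ht 0 < ht 2" "ht 2 < ht 1" | "ht 1 < ht 0" "ht 0 < ht 2"
    | "ht 1 < ht 2" "ht 2 < ht 0" | "ht 2 < ht 0" "ht 0 < ht 1" | "ht 2 < ht 1" "ht 1 < ht 0"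
    by linarith
  then have "\<exists>x y z :: nat. x < 3 \<and> y < 3 \<and> z < 3 \<and> ht z < ht y \<and> ht y < ht x"
  proof cases
    case 1
    then show ?thesis by (intro exI[of _ 2] exI[of _ 1] exI[of _ 0]) simp
  next
    case 2
    then show ?thesis by (intro exI[of _ 1] exI[of _ 2] exI[of _ 0]) simp
  next
    case 3
    then show ?thesis by (intro exI[of _ 2] exI[of _ 0] exI[of _ 1]) simp
  next
    case 4
    then show ?thesis by (intro exI[of _ 0] exI[of _ 2] exI[of _ 1]) simp
  next
    case 5
    then show ?thesis by (intro exI[of _ 1] exI[of _ 0] exI[of _ 2]) simp
  next
    case 6
    then show ?thesis by (intro exI[of _ 0] exI[of _ 1] exI[of _ 2]) simp
  qed
  then obtain x y z :: nat where xyz: "x < 3" "y < 3" "z < 3" "ht z < ht y" "ht y < ht x"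
    by blast
  have ne: "x \<noteq> y" "x \<noteq> z" "y \<noteq> z" using xyz by auto
  let ?t = R3_param and ?\<rho> = "\<lambda>i. if 0 < r i then 1 else (- 1 :: int)"
  define P where "P = (\<lambda>i t. c i + r i * t)"
  have tm: "?t i j \<in> {-1..1}" "- ?t i j \<in> {-1..1}" for i j using R3_param_mem[of i j] by auto
  have "gauss_rep K ({(P x (?t x y), P y (?t x y)), (P x (?t x z), P z (?t x z)),
      (P y (?t y z), P z (?t y z))} \<union> Y)"
    unfolding P_def
    by (rule P.gauss_rep_triangle[OF refl lay(1) R3_above_eq_iff tm(1) R3_param_sym R3_param_neq xyz Y])
  then have 1: "affine_index_polynomial K = gauss_poly (csign K) ({(P x (?t x y), P y (?t x y)),
      (P x (?t x z), P z (?t x z)), (P y (?t y z), P z (?t y z))} \<union> Y)"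
    by (rule affine_index_polynomial_eq[OF K])
  have "gauss_rep K' ({(P x (- ?t x y), P y (- ?t x y)), (P x (- ?t x z), P z (- ?t x z)),
      (P y (- ?t y z), P z (- ?t y z))} \<union> Y)"
    unfolding P_def
    by (rule P'.gauss_rep_triangle[OF refl lay(2) R3_below_eq_iff tm(2) _ _ xyz Y'(1)])
      (use R3_param_sym R3_param_neq in auto)
  then have 2: "affine_index_polynomial K' = gauss_poly (csign K') ({(P x (- ?t x y), P y (- ?t x y)),
      (P x (- ?t x z), P z (- ?t x z)), (P y (- ?t y z), P z (- ?t y z))} \<union> Y)"
    by (rule affine_index_polynomial_eq[OF K'])
  have sg: "csign K (P i (?t i j), P j (?t i j)) = ?\<rho> i * ?\<rho> j * R3_sign i j"
    if "i < 3" "j < 3" "i \<noteq> j" for i j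
  proof -
    have "R3_above i (?t i j) = R3_above j (?t i j)"
      using R3_above_eq_iff[OF that(1,2) tm(1) tm(1)] that(3) by blast
    from P.csign_strand[OF h'(2,3) that(1) R3_param_mem R3_above_deriv that(2) R3_param_mem R3_above_deriv
        this R3_wedge(1)[OF that]]
    show ?thesis unfolding R3_wedge(2)[OF that] P_def .
  qed
  have sg': "csign K' (P i (- ?t i j), P j (- ?t i j)) = ?\<rho> i * ?\<rho> j * R3_sign i j"
    if "i < 3" "j < 3" "i \<noteq> j" for i j
  proof -
    have "R3_below i (- ?t i j) = R3_below j (- ?t i j)"
      using R3_below_eq_iff[OF that(1,2) tm(2) tm(2)] that(3) by blast
    moreover have "- ?t i j \<in> {-1<..<1}" using R3_param_mem[of i j] by auto
    moreover have d: "(R3_below k has_vector_derivative R3_deriv k (?t i j)) (at (- ?t i j))" for k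
      using R3_below_deriv[of k "- ?t i j"] by simp
    ultimately have "csign K' (c i + r i * (- ?t i j), c j + r j * (- ?t i j)) = ?\<rho> i * ?\<rho> j *
        (if 0 < wedge (R3_deriv i (?t i j)) (R3_deriv j (?t i j)) then 1 else - 1)"
      using P'.csign_strand[OF h'(2,3) that(1) _ d that(2) _ d _ R3_wedge(1)[OF that]] by blast
    then show ?thesis unfolding R3_wedge(2)[OF that] P_def .
  qed
  \<comment> \<open>The value is 1 if, along strand \<open>i\<close> of the diagram, the crossing
    with \<open>k\<close> comes before the one with \<open>j\<close>. In the other picture the
    crossing parameters change sign, which turns the value into its complement.\<close>
  define \<alpha> where "\<alpha> = (\<lambda>i j k. of_bool (0 < r i * (?t i j - ?t i k)) :: int)"
  have ord: "\<lceil>P i (?t i j) - P i (?t i k)\<rceil> = \<alpha> i j k" "\<lceil>P i (?t i k) - P i (?t i j)\<rceil> = 1 - \<alpha> i j k"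
      "\<lceil>P i (- ?t i j) - P i (- ?t i k)\<rceil> = 1 - \<alpha> i j k" "\<lceil>P i (- ?t i k) - P i (- ?t i j)\<rceil> = \<alpha> i j k"
      "1 - 2 * \<alpha> i j k = ?\<rho> i * (if ?t i j < ?t i k then 1 else - 1)"
    if ijk: "i < 3" "j < 3" "k < 3" "i \<noteq> j" "i \<noteq> k" "j \<noteq> k" for i j k
  proof -
    note n = R3_param_neq[OF ijk] and ri = r[OF ijk(1)]
    have sw: "(of_bool (0 < r i * (?t i k - ?t i j)) :: int) = 1 - \<alpha> i j k"
      using n ri by (auto simp: \<alpha>_def zero_less_mult_iff not_less)
    show "\<lceil>P i (?t i j) - P i (?t i k)\<rceil> = \<alpha> i j k" "\<lceil>P i (?t i k) - P i (?t i j)\<rceil> = 1 - \<alpha> i j k"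
      using P.ceiling_strand_diff[OF ijk(1) tm(1) tm(1) n] P.ceiling_strand_diff[OF ijk(1) tm(1) tm(1) n[symmetric]]
      unfolding P_def sw by (simp_all add: \<alpha>_def)
    show "\<lceil>P i (- ?t i j) - P i (- ?t i k)\<rceil> = 1 - \<alpha> i j k" "\<lceil>P i (- ?t i k) - P i (- ?t i j)\<rceil> = \<alpha> i j k"
      using P.ceiling_strand_diff[OF ijk(1) tm(2) tm(2), of i j i k]
        P.ceiling_strand_diff[OF ijk(1) tm(2) tm(2), of i k i j] n
      unfolding P_def sw[symmetric] by (simp_all add: \<alpha>_def)
    show "1 - 2 * \<alpha> i j k = ?\<rho> i * (if ?t i j < ?t i k then 1 else - 1)"
      using n ri by (auto simp: \<alpha>_def zero_less_mult_iff not_less)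
  qed
  note oA = ord[OF xyz(1-3) ne] and oB = ord[OF xyz(2,1,3) ne(1)[symmetric] ne(3) ne(2)]
    and oC = ord[OF xyz(3,1,2) ne(2)[symmetric] ne(3)[symmetric] ne(1)]
  note oB' = oB[unfolded R3_param_sym[of y x]] and oC' = oC[unfolded R3_param_sym[of z x] R3_param_sym[of z y]]
  \<comment> \<open>Direction signs square to 1: a strand that occurs twice in a product drops out,
    and the identities of \<open>R3_sign_order\<close> remain.\<close>
  have \<rho>: "?\<rho> i * ?\<rho> j * u * (?\<rho> i * v) = ?\<rho> j * (u * v)"
      "?\<rho> i * ?\<rho> j * u * (?\<rho> j * v) = ?\<rho> i * (u * v)" for i j and u v :: int by simp_all
  have mem: "P i (?t j k) \<in> strand c r i" "P i (- ?t j k) \<in> strand c r i" for i j k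
    unfolding P_def by (rule mem_strandI, rule tm)+
  note so = R3_sign_order[OF xyz(1-3) ne]
  have "gauss_poly (csign K) ({(P x (?t x y), P y (?t x y)),
      (P x (?t x z), P z (?t x z)), (P y (?t y z), P z (?t y z))} \<union> Y) =
      gauss_poly (csign K') ({(P x (- ?t x y), P y (- ?t x y)), (P x (- ?t x z), P z (- ?t x z)),
      (P y (- ?t y z), P z (- ?t y z))} \<union> Y)"
  proof (rule gauss_poly_triangle[where A = "strand c r x" and B = "strand c r y" and C = "strand c r z"
        and \<alpha> = "\<alpha> x y z" and \<beta> = "\<alpha> y x z" and \<gamma> = "\<alpha> z x y"])
    show "finite Y" using Y unfolding outer_rep_def by blast
    show "csign K' d = csign K d" if "d \<in> Y" for d by (rule Y'(2)[OF _ that])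
    show "csign K (P x (?t x y), P y (?t x y)) = ?\<rho> x * ?\<rho> y * R3_sign x y"
      "csign K (P x (?t x z), P z (?t x z)) = ?\<rho> x * ?\<rho> z * R3_sign x z"
      "csign K (P y (?t y z), P z (?t y z)) = ?\<rho> y * ?\<rho> z * R3_sign y z"
      by (rule sg; use xyz ne in simp)+
    show "csign K' (P x (- ?t x y), P y (- ?t x y)) = ?\<rho> x * ?\<rho> y * R3_sign x y"
      "csign K' (P x (- ?t x z), P z (- ?t x z)) = ?\<rho> x * ?\<rho> z * R3_sign x z"
      "csign K' (P y (- ?t y z), P z (- ?t y z)) = ?\<rho> y * ?\<rho> z * R3_sign y z"
      by (rule sg'; use xyz ne in simp)+
    show "?\<rho> x * ?\<rho> z * R3_sign x z * (1 - 2 * \<alpha> x y z) = ?\<rho> y * ?\<rho> z * R3_sign y z * (1 - 2 * \<alpha> y x z)"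
      unfolding oA(5) oB(5) \<rho> using so by presburger
    show "?\<rho> x * ?\<rho> y * R3_sign x y * (1 - 2 * \<alpha> x y z) = ?\<rho> y * ?\<rho> z * R3_sign y z * (1 - 2 * \<alpha> z x y)"
      unfolding oA(5) oC(5) \<rho> using so by presburger
    show "?\<rho> x * ?\<rho> y * R3_sign x y * (1 - 2 * \<alpha> y x z) = ?\<rho> x * ?\<rho> z * R3_sign x z * (1 - 2 * \<alpha> z x y)"
      unfolding oB(5) oC(5) \<rho> using so by presburger
    show "avoids Y (strand c r x)" "avoids Y (strand c r y)" "avoids Y (strand c r z)"
      using P.avoids_outer[OF Y] xyz by blast+
    show "a - b \<notin> \<int>" if "a \<in> strand c r x" "b \<in> strand c r y" for a b
      using P.strand_disjoint xyz ne that by blast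
    show "a - b \<notin> \<int>" if "a \<in> strand c r x" "b \<in> strand c r z" for a b
      using P.strand_disjoint xyz ne that by blast
    show "a - b \<notin> \<int>" if "a \<in> strand c r y" "b \<in> strand c r z" for a b
      using P.strand_disjoint xyz ne that by blast
  qed (rule convex_strand mem oA oB' oC')+
  then show ?thesis unfolding 1 2 by simp
qed

section \<open>Invariance under virtual isotopy\<close>

lemma affine_index_polynomial_step:
  "virtual_isotopy_step K K' \<Longrightarrow> affine_index_polynomial K' = affine_index_polynomial K"
  unfolding virtual_isotopy_step_def
  using affine_index_polynomial_planar_isotopic affine_index_polynomial_reparametrized
    affine_index_polynomial_reidemeister1 affine_index_polynomial_reidemeister2
    affine_index_polynomial_reidemeister3 affine_index_polynomial_detour by blast

lemma affine_index_polynomial_virtually_isotopic: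
  assumes "virtually_isotopic K K'"
  shows "affine_index_polynomial K' = affine_index_polynomial K"
  using assms unfolding virtually_isotopic_def
  by (induction rule: equivclp_induct) (auto dest: affine_index_polynomial_step)


theorem mainTheorem1:
  shows "(\<forall>K K'. virtual_knot_diagram K \<and> virtual_knot_diagram K' \<and> virtually_isotopic K K' \<longrightarrow>
            affine_index_polynomial K = affine_index_polynomial K') \<and>
         (\<exists>P :: vdiagram set \<Rightarrow> laurent_poly. \<forall>K. virtual_knot_diagram K \<longrightarrow>
            P (oriented_virtual_knot K) = affine_index_polynomial K)"
proof (intro conjI allI impI)
  fix K K' assume "virtual_knot_diagram K \<and> virtual_knot_diagram K' \<and> virtually_isotopic K K'"
  then show "affine_index_polynomial K = affine_index_polynomial K'"
    using affine_index_polynomial_virtually_isotopic[of K K'] by simp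
next
  show "\<exists>P :: vdiagram set \<Rightarrow> laurent_poly. \<forall>K. virtual_knot_diagram K \<longrightarrow>
          P (oriented_virtual_knot K) = affine_index_polynomial K"
  proof (intro exI allI impI)
    fix K assume K: "virtual_knot_diagram K"
    have "K \<in> oriented_virtual_knot K"
      using K by (simp add: oriented_virtual_knot_def virtually_isotopic_def)
    \<comment> \<open>The value on a class is the polynomial of an arbitrarily chosen diagram in it.
      The class contains \<open>K\<close>, so the choice is one of its members.\<close>
    then have "(SOME L. L \<in> oriented_virtual_knot K) \<in> oriented_virtual_knot K" by (rule someI)
    then have "virtually_isotopic K (SOME L. L \<in> oriented_virtual_knot K)"
      unfolding oriented_virtual_knot_def by blast
    then show "affine_index_polynomial (SOME L. L \<in> oriented_virtual_knot K) = affine_index_polynomial K"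
      by (rule affine_index_polynomial_virtually_isotopic)
  qed
qed

end
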